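(* There is an algorithm which, given as input the list of vertices $S_1,\dots,S_n$ of a simple polygon $\mathcal{S}$ contained in a plane of $\mathbb{R}^3$ (with $n$ edges), a point $P\in\mathbb{R}^3$, and a real number $d\ge 0$, computes exactly the value $$F_D(d)=\mathbb{P}(D\le d)=\frac{\mathcal{A}\big(\mathcal{S}\cap\mathcal{B}(P,d)\big)}{\mathcal{A}(\mathcal{S})}$$ of the cumulative distribution function of $D=\|\overrightarrow{PX}\|_2$, where $X$ is uniformly distributed in $\mathcal{S}$, using $O(n\ln n)$ operations.
   Context: A simple polygon with vertices $S_1,\dots,S_n$ ($n\ge 3$, the $S_i$ pairwise distinct points of a plane, with $S_{n+1}=S_1$) is the closed bounded region $\mathcal{S}$ of that plane whose boundary is the non-self-intersecting closed polygonal curve $\bigcup_{i=1}^n\overline{S_iS_{i+1}}$. The vertices are listed in order along the boundary so that, for an orientation of the plane, the interior of $\mathcal{S}$ is to the left when travelling from $S_1$ to $S_2$, then from $S_2$ to $S_3$, and so on. $\mathcal{A}$ denotes two-dimensional area in the plane containing $\mathcal{S}$, $\mathcal{B}(P,d)$ is the closed ball of center $P$ and radius $d$ in $\mathbb{R}^3$, and "uniformly distributed in $\mathcal{S}$" is with respect to normalized area measure on $\mathcal{S}$. Complexity is counted in exact real arithmetic: the operations $+,-,\times,/$, comparisons of real numbers, square roots, evaluation of $\arccos$, and use of the constant $\pi$ each have unit cost. *)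

theory Defs
  imports "HOL-Probability.Probability" "HOL-Library.Landau_Symbols"
begin

section \<open>Simple polygons in a plane of space\<close>

type_synonym point = "real^3"

definition plane :: "point set \<Rightarrow> bool" where
  "plane H \<longleftrightarrow> affine H \<and> aff_dim H = 2"

definition polygon_edge :: "point list \<Rightarrow> nat \<Rightarrow> point set" where
  "polygon_edge vs i = closed_segment (vs ! i) (vs ! (Suc i mod length vs))"

definition polygon_curve :: "point list \<Rightarrow> point set" where
  "polygon_curve vs = (\<Union>i<length vs. polygon_edge vs i)"

text \<open>Two different edges may only meet in a common endpoint.\<close>

definition simple_polygon :: "point list \<Rightarrow> bool" where
  "simple_polygon vs \<longleftrightarrow> length vs \<ge> 3 \<and> distinct vs \<and>
     (\<forall>i<length vs. \<forall>j<length vs. i \<noteq> j \<longrightarrow>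
        polygon_edge vs i \<inter> polygon_edge vs j
          \<subseteq> {vs ! i, vs ! (Suc i mod length vs)} \<inter> {vs ! j, vs ! (Suc j mod length vs)})"

text \<open>
  The closed region of the plane \<open>H\<close> bounded by the curve: the curve together with the bounded
  components of its complement in \<open>H\<close>. The library's \<^const>\<open>inside\<close> cannot be used, since it
  takes the complement in the whole space, where a curve encloses nothing.
\<close>

definition polygon_region :: "point set \<Rightarrow> point list \<Rightarrow> point set" where
  "polygon_region H vs = polygon_curve vs \<union>
     {x \<in> H - polygon_curve vs. bounded (connected_component_set (H - polygon_curve vs) x)}"


section \<open>Area in a plane of space\<close>

definition plane_isometry :: "point set \<Rightarrow> (real^2 \<Rightarrow> point) \<Rightarrow> bool" where
  "plane_isometry H f \<longleftrightarrow> (\<forall>x y. dist (f x) (f y) = dist x y) \<and> range f = H"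

text \<open>
  The two-dimensional Lebesgue measure of \<open>H\<close>, as a measure on space concentrated on \<open>H\<close>.
  The choice of the isometry is immaterial, see \<open>plane_area_eq\<close> below.
\<close>

definition plane_area :: "point set \<Rightarrow> point measure" where
  "plane_area H = distr lborel borel (SOME f. plane_isometry H f)"

lemma plane_isometry_exists:
  assumes "plane H"
  shows "\<exists>f. plane_isometry H f"
proof -
  have aff: "affine H" and dim: "aff_dim H = 2"
    using assms by (auto simp: plane_def)
  have "H \<noteq> {}"
    using dim by auto
  then obtain a where a: "a \<in> H"
    by blast
  define V where "V = (\<lambda>x. x - a) ` H"
  have V: "subspace V"
    unfolding V_def by (rule affine_diffs_subspace_subtract[OF aff a])
  have "int (dim V) = 2"
    using aff_dim_translation_eq_subtract[of a H] aff_dim_subspace[OF V] dim unfolding V_def by simp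
  then have "dim (UNIV :: (real^2) set) = dim V"
    by simp
  from isometries_subspaces[OF subspace_UNIV V this]
  obtain f :: "real^2 \<Rightarrow> point" where f: "linear f" "f ` UNIV = V" "\<And>x. norm (f x) = norm x"
    by (metis UNIV_I)
  have "dist (a + f x) (a + f y) = dist x y" for x y
    using f(3)[of "x - y"] by (simp add: dist_norm linear_diff[OF f(1)])
  moreover have "range (\<lambda>x. a + f x) = H"
  proof -
    have "range (\<lambda>x. a + f x) = (\<lambda>v. a + v) ` range f"
      by (simp add: image_image)
    also have "\<dots> = H"
      unfolding f(2) V_def by (simp add: image_image)
    finally show ?thesis .
  qed
  ultimately show ?thesis
    unfolding plane_isometry_def by (intro exI[of _ "\<lambda>x. a + f x"]) simp
qed

lemma plane_isometry_measurable:
  assumes "plane_isometry H f"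
  shows "f \<in> borel_measurable borel"
proof (rule borel_measurable_continuous_onI)
  show "continuous_on UNIV f"
    using assms unfolding plane_isometry_def continuous_on_iff by metis
qed

lemma distr_lborel_isometry:
  fixes h :: "real^2 \<Rightarrow> real^2"
  assumes h: "\<And>x y. dist (h x) (h y) = dist x y"
  shows "distr lborel borel h = lborel"
proof -
  have hm: "h \<in> borel_measurable borel"
    by (intro borel_measurable_continuous_onI) (metis continuous_on_iff h)
  define T where "T x = h x - h 0" for x
  have T: "orthogonal_transformation T"
    unfolding orthogonal_transformation_isometry T_def using h by (auto simp: dist_norm)
  have bij: "bij T" and inv: "orthogonal_transformation (inv T)"
    using T by (simp_all add: orthogonal_transformation_bij orthogonal_transformation_inv)
  show ?thesis
  proof (rule lborel_eqI[symmetric])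
    fix l u :: "real^2"
    assume lu: "\<And>b. b \<in> Basis \<Longrightarrow> l \<bullet> b \<le> u \<bullet> b"
    define B where "B = box (l - h 0) (u - h 0)"
    have "h x \<in> box l u \<longleftrightarrow> T x \<in> B" for x
      by (auto simp: mem_box B_def T_def algebra_simps)
    then have eq: "h -` box l u = inv T ` B"
      using bij by (auto simp: bij_vimage_eq_inv_image[symmetric])
    have B: "B \<in> lmeasurable"
      unfolding B_def by simp
    have meas: "h -` box l u \<in> sets borel"
      using measurable_sets[OF hm, of "box l u"] by simp
    have "emeasure (distr lborel borel h) (box l u) = emeasure lebesgue (inv T ` B)"
      using hm meas by (simp add: emeasure_distr eq)
    also have "\<dots> = ennreal (measure lebesgue B)"
      using measurable_orthogonal_image[OF inv B] measure_orthogonal_image[OF inv B]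
      by (simp add: emeasure_eq_measure2 fmeasurableD2)
    also have "\<dots> = emeasure lborel (box (l - h 0) (u - h 0))"
      using B by (simp add: emeasure_eq_measure2 B_def)
    also have "\<dots> = (\<Prod>b\<in>Basis. (u - l) \<bullet> b)"
      using lu by (subst emeasure_lborel_box) (auto simp: inner_diff_left)
    finally show "emeasure (distr lborel borel h) (box l u) = (\<Prod>b\<in>Basis. (u - l) \<bullet> b)" .
  qed simp
qed

lemma plane_area_eq:
  assumes f: "plane_isometry H f"
  shows "plane_area H = distr lborel borel f"
proof -
  define g where "g = (SOME f. plane_isometry H f)"
  have g: "plane_isometry H g"
    unfolding g_def by (rule someI[where P = "plane_isometry H", OF f])
  have "inj g"
    using g by (metis dist_eq_0_iff injI plane_isometry_def)
  define h where "h = inv g \<circ> f"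
  have gh: "g (h x) = f x" for x
  proof -
    have "f x \<in> range g"
      using f g unfolding plane_isometry_def by blast
    then show ?thesis
      by (simp add: h_def f_inv_into_f)
  qed
  have h: "dist (h x) (h y) = dist x y" for x y
    using f g gh unfolding plane_isometry_def by metis
  then have hm: "h \<in> borel_measurable borel"
    by (intro borel_measurable_continuous_onI) (metis continuous_on_iff)
  have "distr lborel borel g = distr (distr lborel borel h) borel g"
    using distr_lborel_isometry[OF h] by simp
  also have "\<dots> = distr lborel borel (g \<circ> h)"
    by (rule distr_distr) (use hm plane_isometry_measurable[OF g] in auto)
  also have "g \<circ> h = f"
    using gh by auto
  finally show ?thesis
    by (simp add: plane_area_def g_def)
qed


section \<open>The distance from a point to a uniformly distributed point\<close>

definition distance_law :: "point set \<Rightarrow> point set \<Rightarrow> point \<Rightarrow> real measure" where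
  "distance_law H A P = distr (uniform_measure (plane_area H) A) borel (\<lambda>X. norm (X - P))"


section \<open>A random access machine with exact real arithmetic\<close>

text \<open>
  The memory has two unbounded arrays: natural numbers, which serve as counters and addresses, and
  reals. Both can be addressed indirectly. The naturals cannot be multiplied and no real can be
  turned into a natural (no rounding), so exact arithmetic is not abused to pack data into single
  cells. Every node of an expression and every executed command costs one unit, so all memory
  accesses and all bookkeeping are charged in addition to the arithmetic operations.
\<close>

record state =
  nat_mem :: "nat \<Rightarrow> nat"
  real_mem :: "nat \<Rightarrow> real"

datatype nexp =
    NConst nat
  | NLoad nexp
  | NAdd nexp nexp
  | NSub nexp nexp

datatype rexp =
    RConst int
  | RPi
  | RLoad nexp
  | RAdd rexp rexp
  | RSub rexp rexp
  | RMul rexp rexp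
  | RDiv rexp rexp
  | RSqrt rexp
  | RArccos rexp

datatype bexp =
    RLess rexp rexp
  | NLess nexp nexp
  | BNot bexp
  | BAnd bexp bexp

datatype com =
    Skip
  | NStore nexp nexp
  | RStore nexp rexp
  | Seq com com
  | Cond bexp com com
  | While bexp com

primrec nval :: "nexp \<Rightarrow> state \<Rightarrow> nat" where
  "nval (NConst k) s = k"
| "nval (NLoad a) s = nat_mem s (nval a s)"
| "nval (NAdd a b) s = nval a s + nval b s"
| "nval (NSub a b) s = nval a s - nval b s"

primrec rval :: "rexp \<Rightarrow> state \<Rightarrow> real" where
  "rval (RConst k) s = of_int k"
| "rval RPi s = pi"
| "rval (RLoad a) s = real_mem s (nval a s)"
| "rval (RAdd a b) s = rval a s + rval b s"
| "rval (RSub a b) s = rval a s - rval b s"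
| "rval (RMul a b) s = rval a s * rval b s"
| "rval (RDiv a b) s = rval a s / rval b s"
| "rval (RSqrt a) s = sqrt (rval a s)"
| "rval (RArccos a) s = arccos (rval a s)"

primrec bval :: "bexp \<Rightarrow> state \<Rightarrow> bool" where
  "bval (RLess a b) s \<longleftrightarrow> rval a s < rval b s"
| "bval (NLess a b) s \<longleftrightarrow> nval a s < nval b s"
| "bval (BNot a) s \<longleftrightarrow> \<not> bval a s"
| "bval (BAnd a b) s \<longleftrightarrow> bval a s \<and> bval b s"

text \<open>
  The HOL functions above are total; the machine is stuck, and hence computes nothing, when it
  divides by zero or leaves the domain of the square root or of the arccosine.
\<close>

primrec rdefined :: "rexp \<Rightarrow> state \<Rightarrow> bool" where
  "rdefined (RConst k) s \<longleftrightarrow> True"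
| "rdefined RPi s \<longleftrightarrow> True"
| "rdefined (RLoad a) s \<longleftrightarrow> True"
| "rdefined (RAdd a b) s \<longleftrightarrow> rdefined a s \<and> rdefined b s"
| "rdefined (RSub a b) s \<longleftrightarrow> rdefined a s \<and> rdefined b s"
| "rdefined (RMul a b) s \<longleftrightarrow> rdefined a s \<and> rdefined b s"
| "rdefined (RDiv a b) s \<longleftrightarrow> rdefined a s \<and> rdefined b s \<and> rval b s \<noteq> 0"
| "rdefined (RSqrt a) s \<longleftrightarrow> rdefined a s \<and> 0 \<le> rval a s"
| "rdefined (RArccos a) s \<longleftrightarrow> rdefined a s \<and> -1 \<le> rval a s \<and> rval a s \<le> 1"

primrec bdefined :: "bexp \<Rightarrow> state \<Rightarrow> bool" where
  "bdefined (RLess a b) s \<longleftrightarrow> rdefined a s \<and> rdefined b s"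
| "bdefined (NLess a b) s \<longleftrightarrow> True"
| "bdefined (BNot a) s \<longleftrightarrow> bdefined a s"
| "bdefined (BAnd a b) s \<longleftrightarrow> bdefined a s \<and> bdefined b s"

primrec ncost :: "nexp \<Rightarrow> nat" where
  "ncost (NConst k) = 1"
| "ncost (NLoad a) = 1 + ncost a"
| "ncost (NAdd a b) = 1 + ncost a + ncost b"
| "ncost (NSub a b) = 1 + ncost a + ncost b"

primrec rcost :: "rexp \<Rightarrow> nat" where
  "rcost (RConst k) = 1"
| "rcost RPi = 1"
| "rcost (RLoad a) = 1 + ncost a"
| "rcost (RAdd a b) = 1 + rcost a + rcost b"
| "rcost (RSub a b) = 1 + rcost a + rcost b"
| "rcost (RMul a b) = 1 + rcost a + rcost b"
| "rcost (RDiv a b) = 1 + rcost a + rcost b"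
| "rcost (RSqrt a) = 1 + rcost a"
| "rcost (RArccos a) = 1 + rcost a"

primrec bcost :: "bexp \<Rightarrow> nat" where
  "bcost (RLess a b) = 1 + rcost a + rcost b"
| "bcost (NLess a b) = 1 + ncost a + ncost b"
| "bcost (BNot a) = 1 + bcost a"
| "bcost (BAnd a b) = 1 + bcost a + bcost b"

text \<open>
  \<open>exec c s t s'\<close>: started in \<open>s\<close>, the command \<open>c\<close> halts in \<open>s'\<close> after exactly \<open>t\<close> operations.
\<close>

inductive exec :: "com \<Rightarrow> state \<Rightarrow> nat \<Rightarrow> state \<Rightarrow> bool" where
  Skip: "exec Skip s 1 s"
| NStore: "exec (NStore a e) s (1 + ncost a + ncost e)
             (s\<lparr>nat_mem := (nat_mem s)(nval a s := nval e s)\<rparr>)"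
| RStore: "rdefined e s \<Longrightarrow>
           exec (RStore a e) s (1 + ncost a + rcost e)
             (s\<lparr>real_mem := (real_mem s)(nval a s := rval e s)\<rparr>)"
| Seq: "exec c\<^sub>1 s t\<^sub>1 s' \<Longrightarrow> exec c\<^sub>2 s' t\<^sub>2 s'' \<Longrightarrow>
        exec (Seq c\<^sub>1 c\<^sub>2) s (1 + t\<^sub>1 + t\<^sub>2) s''"
| CondTrue: "bdefined b s \<Longrightarrow> bval b s \<Longrightarrow> exec c\<^sub>1 s t s' \<Longrightarrow>
           exec (Cond b c\<^sub>1 c\<^sub>2) s (1 + bcost b + t) s'"
| CondFalse: "bdefined b s \<Longrightarrow> \<not> bval b s \<Longrightarrow> exec c\<^sub>2 s t s' \<Longrightarrow>
            exec (Cond b c\<^sub>1 c\<^sub>2) s (1 + bcost b + t) s'"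
| WhileFalse: "bdefined b s \<Longrightarrow> \<not> bval b s \<Longrightarrow>
               exec (While b c) s (1 + bcost b) s"
| WhileTrue: "bdefined b s \<Longrightarrow> bval b s \<Longrightarrow> exec c s t\<^sub>1 s' \<Longrightarrow>
              exec (While b c) s' t\<^sub>2 s'' \<Longrightarrow>
              exec (While b c) s (1 + bcost b + t\<^sub>1 + t\<^sub>2) s''"

inductive_cases exec_SkipE: "exec Skip s t s'"
inductive_cases exec_NStoreE: "exec (NStore a e) s t s'"
inductive_cases exec_RStoreE: "exec (RStore a e) s t s'"
inductive_cases exec_SeqE: "exec (Seq c\<^sub>1 c\<^sub>2) s t s'"
inductive_cases exec_CondE: "exec (Cond b c\<^sub>1 c\<^sub>2) s t s'"
inductive_cases exec_WhileE: "exec (While b c) s t s'"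

lemma exec_deterministic:
  "exec c s t s' \<Longrightarrow> exec c s u s'' \<Longrightarrow> u = t \<and> s'' = s'"
proof (induction arbitrary: u s'' rule: exec.induct)
  case Skip then show ?case by (auto elim: exec_SkipE)
next
  case NStore then show ?case by (auto elim: exec_NStoreE)
next
  case RStore then show ?case by (auto elim: exec_RStoreE)
next
  case (Seq c\<^sub>1 s t\<^sub>1 s' c\<^sub>2 t\<^sub>2 s2)
  from Seq.prems obtain v\<^sub>1 r v\<^sub>2 where
    u: "u = 1 + v\<^sub>1 + v\<^sub>2" and 1: "exec c\<^sub>1 s v\<^sub>1 r" and 2: "exec c\<^sub>2 r v\<^sub>2 s''"
    by (rule exec_SeqE) (rule that; simp)
  from Seq.IH(1)[OF 1] have "v\<^sub>1 = t\<^sub>1" "r = s'" by auto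
  with Seq.IH(2) 2 u show ?case by simp
next
  case (CondTrue b s c\<^sub>1 t s' c\<^sub>2)
  from CondTrue.prems CondTrue.hyps(2)
  have "\<exists>v. u = 1 + bcost b + v \<and> exec c\<^sub>1 s v s''"
    by (auto elim: exec_CondE)
  then obtain v where u: "u = 1 + bcost b + v" and 1: "exec c\<^sub>1 s v s''"
    by blast
  from CondTrue.IH[OF 1] u show ?case by simp
next
  case (CondFalse b s c\<^sub>2 t s' c\<^sub>1)
  from CondFalse.prems CondFalse.hyps(2)
  have "\<exists>v. u = 1 + bcost b + v \<and> exec c\<^sub>2 s v s''"
    by (auto elim: exec_CondE)
  then obtain v where u: "u = 1 + bcost b + v" and 1: "exec c\<^sub>2 s v s''"
    by blast
  from CondFalse.IH[OF 1] u show ?case by simp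
next
  case (WhileFalse b s c)
  from WhileFalse.prems WhileFalse.hyps(2) show ?case
    by (auto elim: exec_WhileE)
next
  case (WhileTrue b s c t\<^sub>1 s' t\<^sub>2 s2)
  from WhileTrue.prems
  have "\<exists>v\<^sub>1 r v\<^sub>2. u = 1 + bcost b + v\<^sub>1 + v\<^sub>2 \<and> exec c s v\<^sub>1 r \<and> exec (While b c) r v\<^sub>2 s''"
  proof (rule exec_WhileE)
    assume "\<not> bval b s"
    with WhileTrue.hyps(2) show ?thesis by simp
  next
    fix v\<^sub>1 r v\<^sub>2
    assume "u = Suc (bcost b + v\<^sub>1 + v\<^sub>2)" "exec c s v\<^sub>1 r" "exec (While b c) r v\<^sub>2 s''"
    then show ?thesis
      by (intro exI[of _ v\<^sub>1] exI[of _ r] exI[of _ v\<^sub>2]) simp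
  qed
  then obtain v\<^sub>1 r v\<^sub>2 where
    u: "u = 1 + bcost b + v\<^sub>1 + v\<^sub>2" and 1: "exec c s v\<^sub>1 r" and 2: "exec (While b c) r v\<^sub>2 s''"
    by blast
  from WhileTrue.IH(1)[OF 1] have "v\<^sub>1 = t\<^sub>1" "r = s'" by auto
  with WhileTrue.IH(2) 2 u show ?case by simp
qed


section \<open>Input and output\<close>

definition coords :: "point \<Rightarrow> real list" where
  "coords x = [x $ 1, x $ 2, x $ 3]"

text \<open>
  Initially the first natural cell holds the number of vertices, and the real cells hold the
  coordinates of \<open>P\<close>, then \<open>d\<close>, then the coordinates of the vertices in order; all other cells are
  zero. The result is read from the first real cell.
\<close>

definition input :: "point list \<Rightarrow> point \<Rightarrow> real \<Rightarrow> state" where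
  "input vs P d =
     (let xs = coords P @ [d] @ concat (map coords vs) in
      \<lparr>nat_mem = (\<lambda>a. if a = 0 then length vs else 0),
       real_mem = (\<lambda>a. if a < length xs then xs ! a else 0)\<rparr>)"

definition result :: "state \<Rightarrow> real" where
  "result s = real_mem s 0"

end

theory Submission
  imports Defs "HOL-Complex_Analysis.Complex_Analysis"
begin

text \<open>
  Let \<open>C\<close> be the foot of the perpendicular from \<open>P\<close> to the plane. The ball meets the plane in a disc around
  \<open>C\<close>, so what has to be computed is the area of a polygon cut by a disc. This is done edge by edge:
  up to finitely many segments, the indicator function of the polygon is, up to a global sign, the sum
  over the edges \<open>ab\<close> of the indicators of the triangles \<open>Cab\<close>, each weighted with its orientation. Indeed
  the winding number of the boundary around a point is \<open>\<plusminus>1\<close> inside and \<open>0\<close> outside (Jordan), and it is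
  the sum of the winding numbers of the closed paths \<open>C \<rightarrow> a \<rightarrow> b \<rightarrow> C\<close>, because the contributions of the
  spokes \<open>Ca\<close> cancel cyclically; see \<open>region_signed_wedges\<close>.

  With \<open>C\<close> as the origin, \<open>D = det (a, b)\<close> and \<open>q s = |a + s (b - a)|\<^sup>2\<close>, slicing the triangle by parallels
  to \<open>ab\<close> shows that it meets the disc of squared radius \<open>R\<close> in the area
  \<open>|D| / 2 * \<integral> min 1 (R / q s) ds\<close> over \<open>[0, 1]\<close> (\<open>measure_wedge_disc_integral\<close>). Since \<open>q\<close> is a quadratic
  polynomial, the integral has a closed form in arctangents (\<open>clamp_term_has_integral\<close>), and
  \<open>arctan x = \<pi> / 2 - arccos (x / sqrt (1 + x\<^sup>2))\<close> makes it computable with the available operations.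

  No coordinate system of the plane has to be computed. The vector \<open>N = \<Sum> (a - P) \<times> (b - P)\<close> over the
  edges is normal to the plane, its length is twice the area of the polygon, and its direction encodes
  the orientation of the boundary, so that \<open>N \<bullet> ((a - P) \<times> (b - P)) / |N|\<close> is the determinant \<open>D\<close>
  already corrected by the global sign (\<open>polygon_region_disc_area\<close>).

  The resulting program makes two passes over the edges with a constant amount of work per edge. It
  takes \<open>O(n)\<close> operations, which is more than is asked for (\<open>exec_cdf_program\<close>).
\<close>

unbundle no fps_syntax

section \<open>The area of a triangle cut by a disc around one of its vertices\<close>

text \<open>
  Area is needed in three guises of the plane: \<open>real \<times> real\<close> for Fubini, \<open>complex\<close> for winding numbers
  and \<open>real^2\<close> for determinants. Passing from one to the other only renames the standard basis.
\<close>

lemma distr_lborel_relabel: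
  fixes f :: "'a::euclidean_space \<Rightarrow> 'b::euclidean_space"
  assumes f: "linear f" and Basis: "bij_betw f Basis Basis"
  shows "distr lborel borel f = lborel"
proof (rule lborel_eqI[symmetric])
  have inner: "f x \<bullet> f b = x \<bullet> b" if "b \<in> Basis" for x b
  proof -
    have "f x = f (\<Sum>c\<in>Basis. (x \<bullet> c) *\<^sub>R c)"
      by (simp add: euclidean_representation)
    also have "\<dots> = (\<Sum>c\<in>Basis. (x \<bullet> c) *\<^sub>R f c)"
      by (simp add: linear_sum[OF f] linear_cmul[OF f])
    finally have "f x \<bullet> f b = (\<Sum>c\<in>Basis. (x \<bullet> c) * (f c \<bullet> f b))"
      by (simp add: inner_sum_left)
    also have "\<dots> = (\<Sum>c\<in>Basis. (x \<bullet> c) * (c \<bullet> b))"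
    proof (rule sum.cong[OF refl])
      fix c :: 'a assume c: "c \<in> Basis"
      have "f c \<in> Basis" "f b \<in> Basis" "f c = f b \<longleftrightarrow> c = b"
        using Basis c that by (auto simp: bij_betw_def inj_on_eq_iff)
      then show "(x \<bullet> c) * (f c \<bullet> f b) = (x \<bullet> c) * (c \<bullet> b)"
        using c that by (simp add: inner_Basis)
    qed
    also have "\<dots> = x \<bullet> b"
      using that by (simp add: inner_Basis if_distrib cong: if_cong)
    finally show ?thesis .
  qed
  fix l u :: 'b
  assume lu: "\<And>b. b \<in> Basis \<Longrightarrow> l \<bullet> b \<le> u \<bullet> b"
  \<comment> \<open>the adjoint of \<open>f\<close>; the preimage of a box is again a box, with pulled back corners\<close>
  define pull where "pull y = (\<Sum>b\<in>Basis. (y \<bullet> f b) *\<^sub>R b)" for y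
  have pull: "pull y \<bullet> b = y \<bullet> f b" if "b \<in> Basis" for y b
    unfolding pull_def using that by (simp add: inner_sum_left inner_Basis if_distrib cong: if_cong)
  have image: "Basis = f ` Basis" using Basis by (simp add: bij_betw_def)
  have vimage: "f -` box l u = box (pull l) (pull u)"
  proof -
    have "x \<in> f -` box l u \<longleftrightarrow> x \<in> box (pull l) (pull u)" for x
      unfolding vimage_eq mem_box by (subst image) (simp add: inner pull)
    then show ?thesis by blast
  qed
  have "emeasure (distr lborel borel f) (box l u) = emeasure lborel (f -` box l u)"
    using linear_continuous_on[OF f[unfolded linear_conv_bounded_linear], of UNIV]
    by (subst emeasure_distr) (auto intro: borel_measurable_continuous_onI)
  also have "\<dots> = (\<Prod>b\<in>Basis. (pull u - pull l) \<bullet> b)"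
    unfolding vimage using lu image by (subst emeasure_lborel_box) (auto simp: pull inner_diff_left)
  also have "\<dots> = (\<Prod>b\<in>Basis. (u - l) \<bullet> f b)"
    by (simp add: pull inner_diff_left)
  also have "\<dots> = (\<Prod>b\<in>Basis. (u - l) \<bullet> b)"
    using prod.reindex_bij_betw[OF Basis, of "\<lambda>c. (u - l) \<bullet> c"] by simp
  finally show "emeasure (distr lborel borel f) (box l u) = (\<Prod>b\<in>Basis. (u - l) \<bullet> b)" .
qed simp

definition complex_vec :: "complex \<Rightarrow> real^2" where
  "complex_vec z = vector [Re z, Im z]"

definition pair_complex :: "real \<times> real \<Rightarrow> complex" where
  "pair_complex p = Complex (fst p) (snd p)"

lemma complex_vec_nth [simp]: "complex_vec z $ 1 = Re z" "complex_vec z $ 2 = Im z"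
  by (simp_all add: complex_vec_def)

lemma linear_complex_vec: "linear complex_vec"
  by (rule linearI) (simp_all add: vec_eq_iff forall_2)

lemma linear_pair_complex: "linear pair_complex"
  by (rule linearI) (simp_all add: pair_complex_def complex_eq_iff)

lemma bij_complex_vec: "bij complex_vec"
proof (rule bijI)
  show "inj complex_vec" by (rule injI) (simp add: vec_eq_iff forall_2 complex_eq_iff)
  have "complex_vec (Complex (x $ 1) (x $ 2)) = x" for x by (simp add: vec_eq_iff forall_2)
  then show "surj complex_vec" by (intro surjI)
qed

lemma distr_complex_vec: "distr lborel borel complex_vec = lborel"
proof (rule distr_lborel_relabel[OF linear_complex_vec])
  have "complex_vec 1 = axis 1 1" "complex_vec \<i> = axis 2 1"
    by (simp_all add: vec_eq_iff forall_2 axis_def)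
  then show "bij_betw complex_vec Basis Basis"
    using bij_complex_vec
    by (auto simp: bij_betw_def Basis_complex_def Basis_vec_def UNIV_2 inj_on_def)
qed

lemma distr_pair_complex: "distr lborel borel pair_complex = lborel"
proof (rule distr_lborel_relabel[OF linear_pair_complex])
  show "bij_betw pair_complex Basis Basis"
    by (auto simp: bij_betw_def Basis_complex_def Basis_prod_def pair_complex_def inj_on_def complex_eq_iff)
qed

lemma measurable_complex_vec [measurable]: "complex_vec \<in> borel_measurable borel"
  using linear_complex_vec
  by (intro borel_measurable_continuous_onI) (simp add: linear_conv_bounded_linear linear_continuous_on)

lemma measurable_pair_complex [measurable]: "pair_complex \<in> borel_measurable borel"
  using linear_pair_complex
  by (intro borel_measurable_continuous_onI) (simp add: linear_conv_bounded_linear linear_continuous_on)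

lemma measure_complex_vec_image:
  assumes "compact S"
  shows "measure lborel (complex_vec ` S) = measure lborel S"
proof -
  have "compact (complex_vec ` S)"
    using linear_complex_vec assms
    by (intro compact_continuous_image) (simp_all add: linear_conv_bounded_linear linear_continuous_on)
  then have "measure (distr lborel borel complex_vec) (complex_vec ` S) =
      measure lborel (complex_vec -` complex_vec ` S)"
    by (subst measure_distr) (auto simp: borel_compact)
  then show ?thesis
    by (simp add: distr_complex_vec bij_is_inj[OF bij_complex_vec] inj_vimage_image_eq)
qed

text \<open>
  The orientation form of the plane: twice the signed area of the triangle \<open>0, a, b\<close>.
\<close>

definition cdet :: "complex \<Rightarrow> complex \<Rightarrow> real" where
  "cdet a b = Re a * Im b - Im a * Re b"

lemma cdet_nonzero_segment:
  assumes "cdet a b \<noteq> 0"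
  shows "a + s *\<^sub>R (b - a) \<noteq> 0"
proof
  assume "a + s *\<^sub>R (b - a) = 0"
  then have "cdet (a + s *\<^sub>R (b - a)) (b - a) = 0" by (simp add: cdet_def)
  moreover have "cdet (a + s *\<^sub>R (b - a)) (b - a) = cdet a b" by (simp add: cdet_def algebra_simps)
  ultimately show False using assms by simp
qed

lemma measure_linear_image_complex:
  assumes "compact E"
  shows "measure lborel ((\<lambda>z. Re z *\<^sub>R a + Im z *\<^sub>R c) ` E) = \<bar>cdet a c\<bar> * measure lborel E"
proof -
  define M :: "real^2 \<Rightarrow> real^2" where "M p = complex_vec ((p $ 1) *\<^sub>R a + (p $ 2) *\<^sub>R c)" for p
  let ?L = "\<lambda>z. Re z *\<^sub>R a + Im z *\<^sub>R c"
  have M: "linear M"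
    unfolding M_def by (rule linearI) (simp_all add: vec_eq_iff forall_2 algebra_simps)
  have det: "det (matrix M) = cdet a c"
    by (simp add: det_2 matrix_def M_def cdet_def axis_def)
  have cont: "continuous_on UNIV ?L" by (intro continuous_intros)
  have image: "complex_vec ` ?L ` E = M ` complex_vec ` E"
    unfolding image_image M_def by simp
  have cE: "compact (?L ` E)" "compact (complex_vec ` E)"
    using linear_complex_vec assms
    by (auto intro!: compact_continuous_image continuous_on_subset[OF cont]
      simp: linear_conv_bounded_linear linear_continuous_on)
  then have "complex_vec ` E \<in> lmeasurable" by (simp add: lmeasurable_compact)
  then have "measure lebesgue (M ` complex_vec ` E) = \<bar>cdet a c\<bar> * measure lebesgue (complex_vec ` E)"
    using measure_linear_image[OF M] by (simp add: det)
  moreover have "compact (M ` complex_vec ` E)"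
    using M by (intro compact_continuous_image cE(2)) (simp add: linear_conv_bounded_linear linear_continuous_on)
  ultimately have "measure lborel (M ` complex_vec ` E) = \<bar>cdet a c\<bar> * measure lborel (complex_vec ` E)"
    using cE(2) by (simp add: borel_compact)
  then show ?thesis
    using cE assms by (simp add: image[symmetric] measure_complex_vec_image)
qed

definition wedge :: "complex \<Rightarrow> complex \<Rightarrow> complex set" where
  "wedge a b = convex hull {0, a, b}"

lemma wedge_eq_image:
  "wedge a b = (\<lambda>z. Re z *\<^sub>R a + Im z *\<^sub>R (b - a)) ` {z. 0 \<le> Im z \<and> Im z \<le> Re z \<and> Re z \<le> 1}"
    (is "_ = ?L ` ?E")
proof
  show "wedge a b \<subseteq> ?L ` ?E"
  proof
    fix z assume "z \<in> wedge a b"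
    then obtain u v where uv: "0 \<le> u" "0 \<le> v" "u + v \<le> 1" "z = u *\<^sub>R a + v *\<^sub>R b"
      unfolding wedge_def convex_hull_3_alt by auto
    then have "z = ?L (Complex (u + v) v)" by (simp add: algebra_simps)
    then show "z \<in> ?L ` ?E" by (rule image_eqI) (use uv in simp)
  qed
  show "?L ` ?E \<subseteq> wedge a b"
  proof clarify
    fix z assume z: "0 \<le> Im z" "Im z \<le> Re z" "Re z \<le> 1"
    then show "?L z \<in> wedge a b"
      unfolding wedge_def convex_hull_3_alt
      by (intro CollectI exI[of _ "Re z - Im z"] exI[of _ "Im z"]) (simp add: algebra_simps)
  qed
qed

lemma nn_integral_ident_Icc:
  assumes "0 \<le> m"
  shows "(\<integral>\<^sup>+u. ennreal u * indicator {0..m} u \<partial>lborel) = ennreal (m\<^sup>2 / 2)"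
proof -
  have "((\<lambda>u. u) has_integral (m\<^sup>2 - 0\<^sup>2) / 2) {0..m}"
    using assms by (rule ident_has_integral)
  then show ?thesis
    using nn_integral_has_integral_lebesgue'[of "{0..m}" "\<lambda>u. u" "m\<^sup>2 / 2"] by simp
qed

text \<open>
  The set is the parameter domain of a triangle with apex \<open>0\<close> that is cut by a disc of radius \<open>r\<close>: the
  first coordinate \<open>u\<close> is the height of a slice, \<open>N\<close> the distance to the apex, which is homogeneous, and
  \<open>\<rho> s\<close> its value at the point \<open>s\<close> of the side opposite to the apex. Rescaling the slice at height \<open>u\<close> to the
  unit interval costs a factor \<open>u\<close>. After exchanging the integrations, the integral of \<open>u\<close> up to
  \<open>min 1 (r / \<rho> s)\<close> remains for each \<open>s\<close>.
\<close>

lemma emeasure_wedge_domain: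
  fixes \<rho> :: "real \<Rightarrow> real"
  assumes hom: "\<And>u s. 0 < u \<Longrightarrow> N (u, u * s) = u * \<rho> s"
    and \<rho>: "\<And>s. 0 < \<rho> s" and r: "0 \<le> r"
    and N: "N \<in> borel_measurable borel" and \<rho>m: "\<rho> \<in> borel_measurable borel"
    and I: "((\<lambda>s. min 1 (r\<^sup>2 / (\<rho> s)\<^sup>2)) has_integral I) {0..1}"
  shows "emeasure lborel {p :: real \<times> real. 0 \<le> snd p \<and> snd p \<le> fst p \<and> fst p \<le> 1 \<and> N p \<le> r}
    = ennreal (I / 2)" (is "emeasure lborel ?E = _")
proof -
  note [measurable] = N \<rho>m
  define G :: "real \<Rightarrow> real \<Rightarrow> ennreal" where
    "G u s = ennreal u * indicator {u. 0 < u \<and> u \<le> 1 \<and> u * \<rho> s \<le> r} u * indicator {0..1} s" for u s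
  have G_measurable: "(\<lambda>(u, s). G u s) \<in> borel_measurable (lborel \<Otimes>\<^sub>M lborel)"
  proof -
    have "(\<lambda>(u, s). G u s) = (\<lambda>p. ennreal (fst p) *
        indicator {p \<in> space (borel \<Otimes>\<^sub>M borel). 0 < fst p \<and> fst p \<le> 1 \<and> fst p * \<rho> (snd p) \<le> r
          \<and> 0 \<le> snd p \<and> snd p \<le> 1} p)"
      by (auto simp: G_def indicator_def space_pair_measure)
    moreover have "\<dots> \<in> borel_measurable (borel \<Otimes>\<^sub>M borel)"
      by measurable
    ultimately show ?thesis
      by (simp add: lborel_prod borel_prod)
  qed
  have E: "?E \<in> sets borel"
  proof -
    note [measurable] = N[unfolded borel_prod[symmetric]]
    have "{p \<in> space (borel \<Otimes>\<^sub>M borel). 0 \<le> snd p \<and> snd p \<le> fst p \<and> fst p \<le> 1 \<and> N p \<le> r}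
        \<in> sets (borel \<Otimes>\<^sub>M borel)"
      by measurable
    then show ?thesis unfolding borel_prod by simp
  qed
  have slice: "(\<integral>\<^sup>+y. indicator ?E (u, y) \<partial>lborel) = (\<integral>\<^sup>+s. G u s \<partial>lborel)" for u
  proof (cases "0 < u")
    case True
    have m: "(\<lambda>y. indicator ?E (u, y) :: ennreal) \<in> borel_measurable borel"
      by (rule measurable_compose[OF _ borel_measurable_indicator[OF E]])
        (intro borel_measurable_continuous_onI continuous_intros)
    have "(\<integral>\<^sup>+y. indicator ?E (u, y) \<partial>lborel) = ennreal u * (\<integral>\<^sup>+s. indicator ?E (u, u * s) \<partial>lborel)"
      using nn_integral_real_affine[OF m, of u 0] True by simp
    also have "\<dots> = (\<integral>\<^sup>+s. ennreal u * indicator ?E (u, u * s) \<partial>lborel)"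
      by (rule nn_integral_cmult[symmetric], rule measurable_compose[OF _ borel_measurable_indicator[OF E]])
        (auto intro!: borel_measurable_continuous_onI continuous_intros)
    also have "\<dots> = (\<integral>\<^sup>+s. G u s \<partial>lborel)"
    proof (rule nn_integral_cong)
      fix s
      have "u * s \<le> u \<longleftrightarrow> s \<le> 1" "0 \<le> u * s \<longleftrightarrow> 0 \<le> s"
        using True by (simp_all add: zero_le_mult_iff)
      then show "ennreal u * indicator ?E (u, u * s) = G u s"
        using True by (auto simp: G_def hom indicator_def)
    qed
    finally show ?thesis .
  next
    case False
    then have "(\<integral>\<^sup>+y. indicator ?E (u, y) \<partial>lborel) \<le> (\<integral>\<^sup>+y. indicator {0} y \<partial>(lborel :: real measure))"
      by (intro nn_integral_mono) (auto simp: indicator_def)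
    then have "(\<integral>\<^sup>+y. indicator ?E (u, y) \<partial>lborel) = 0"
      by simp
    with False show ?thesis by (simp add: G_def)
  qed
  have inner: "(\<integral>\<^sup>+u. G u s \<partial>lborel) = ennreal (min 1 (r\<^sup>2 / (\<rho> s)\<^sup>2) / 2) * indicator {0..1} s" for s
  proof -
    define m where "m = min 1 (r / \<rho> s)"
    have m: "0 \<le> m" using r \<rho>[of s] by (simp add: m_def less_imp_le)
    have "G u s = (ennreal u * indicator {0..m} u) * indicator {0..1} s" for u
      using \<rho>[of s] by (auto simp: G_def indicator_def m_def field_simps)
    then have "(\<integral>\<^sup>+u. G u s \<partial>lborel) = (\<integral>\<^sup>+u. ennreal u * indicator {0..m} u \<partial>lborel) * indicator {0..1} s"
      by (simp add: nn_integral_multc)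
    also have "\<dots> = ennreal (m\<^sup>2 / 2) * indicator {0..1} s"
      using m by (simp add: nn_integral_ident_Icc)
    also have "m\<^sup>2 = min 1 (r\<^sup>2 / (\<rho> s)\<^sup>2)"
    proof (cases "r \<le> \<rho> s")
      case True
      then have "r\<^sup>2 \<le> (\<rho> s)\<^sup>2" using r by (intro power_mono)
      then show ?thesis using True \<rho>[of s] by (simp add: m_def power_divide min_def)
    next
      case False
      then have "(\<rho> s)\<^sup>2 < r\<^sup>2" using \<rho>[of s] by (intro power_strict_mono) auto
      then show ?thesis using False \<rho>[of s] by (simp add: m_def power_divide min_def)
    qed
    finally show ?thesis .
  qed
  have "emeasure lborel ?E = (\<integral>\<^sup>+u. \<integral>\<^sup>+y. indicator ?E (u, y) \<partial>lborel \<partial>lborel)"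
    using E unfolding lborel_prod[symmetric] by (intro lborel.emeasure_pair_measure) (simp only: lborel_prod sets_lborel)
  also have "\<dots> = (\<integral>\<^sup>+u. \<integral>\<^sup>+s. G u s \<partial>lborel \<partial>lborel)"
    by (simp add: slice)
  also have "\<dots> = (\<integral>\<^sup>+s. \<integral>\<^sup>+u. G u s \<partial>lborel \<partial>lborel)"
    by (rule lborel_pair.Fubini'[OF G_measurable, symmetric])
  also have "\<dots> = (\<integral>\<^sup>+s. ennreal (min 1 (r\<^sup>2 / (\<rho> s)\<^sup>2) / 2) * indicator {0..1} s \<partial>lborel)"
    by (simp add: inner)
  also have "\<dots> = ennreal (I / 2)"
    using has_integral_mult_left[OF I, of "1/2"]
    by (intro nn_integral_has_integral_lebesgue') simp_all
  finally show ?thesis .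
qed

lemma emeasure_pair_complex:
  assumes "S \<in> sets borel"
  shows "emeasure lborel S = emeasure lborel (pair_complex -` S)"
proof -
  have "emeasure lborel S = emeasure (distr lborel borel pair_complex) S"
    by (simp add: distr_pair_complex)
  also have "\<dots> = emeasure lborel (pair_complex -` S)"
    using assms by (subst emeasure_distr) auto
  finally show ?thesis .
qed

lemma measure_wedge_disc_integral:
  assumes D: "cdet a b \<noteq> 0" and r: "0 \<le> r"
    and I: "((\<lambda>s. min 1 (r\<^sup>2 / (norm (a + s *\<^sub>R (b - a)))\<^sup>2)) has_integral I) {0..1}"
  shows "measure lborel (wedge a b \<inter> cball 0 r) = \<bar>cdet a b\<bar> * I / 2"
proof -
  let ?L = "\<lambda>z. Re z *\<^sub>R a + Im z *\<^sub>R (b - a)"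
  define E where "E = {z. 0 \<le> Im z \<and> Im z \<le> Re z \<and> Re z \<le> 1 \<and> norm (?L z) \<le> r}"
  have L: "continuous_on UNIV ?L" by (intro continuous_intros)
  have "closed E"
    unfolding E_def by (intro closed_Collect_conj closed_Collect_le continuous_intros)
  moreover have "bounded E"
  proof (rule boundedI)
    fix z assume "z \<in> E"
    then show "norm z \<le> 2" using cmod_le[of z] by (auto simp: E_def)
  qed
  ultimately have E: "compact E" by (simp add: compact_eq_bounded_closed)
  have "wedge a b \<inter> cball 0 r = ?L ` E"
    unfolding wedge_eq_image E_def by auto
  then have "measure lborel (wedge a b \<inter> cball 0 r) = \<bar>cdet a (b - a)\<bar> * measure lborel E"
    using measure_linear_image_complex[OF E] by simp
  also have "cdet a (b - a) = cdet a b"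
    by (simp add: cdet_def algebra_simps)
  also have "measure lborel E = I / 2"
  proof -
    have "emeasure lborel E = emeasure lborel (pair_complex -` E)"
      using E by (intro emeasure_pair_complex) (simp add: borel_compact)
    also have "pair_complex -` E = {p. 0 \<le> snd p \<and> snd p \<le> fst p \<and> fst p \<le> 1 \<and> norm (?L (pair_complex p)) \<le> r}"
      by (auto simp: E_def pair_complex_def)
    also have "emeasure lborel \<dots> = ennreal (I / 2)"
    proof (rule emeasure_wedge_domain)
      fix u s :: real assume "0 < u"
      have "?L (pair_complex (u, u * s)) = u *\<^sub>R (a + s *\<^sub>R (b - a))"
        by (simp add: pair_complex_def algebra_simps)
      then show "norm (?L (pair_complex (u, u * s))) = u * norm (a + s *\<^sub>R (b - a))"
        using \<open>0 < u\<close> by simp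
    next
      show "(\<lambda>p. norm (?L (pair_complex p))) \<in> borel_measurable borel"
        by (intro borel_measurable_continuous_onI continuous_intros) (auto simp: pair_complex_def intro!: continuous_intros)
      show "(\<lambda>s. norm (a + s *\<^sub>R (b - a))) \<in> borel_measurable borel"
        by (intro borel_measurable_continuous_onI continuous_intros)
    qed (use D r I in \<open>auto simp: cdet_nonzero_segment\<close>)
    finally have "emeasure lborel E = ennreal (I / 2)" .
    moreover have "0 \<le> I" using I by (rule has_integral_nonneg) simp
    ultimately show ?thesis by (simp add: measure_def)
  qed
  finally show ?thesis by simp
qed

text \<open>
  Substituting \<open>u = g s + h\<close> turns \<open>g * q s\<close> into \<open>u\<^sup>2 + D\<^sup>2\<close>, and \<open>R / q s\<close> exceeds \<open>1\<close> exactly for \<open>|u| < w\<close>.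
  So a primitive of \<open>D * min 1 (R / q s)\<close> is linear on \<open>[-w, w]\<close> and an arctangent outside. Cutting \<open>u\<close> off
  at \<open>\<plusminus>w\<close> gives both branches by a single formula, also when the line misses the disc, where \<open>w = 0\<close>.
\<close>

definition clamp_term :: "real \<Rightarrow> real \<Rightarrow> real \<Rightarrow> real \<Rightarrow> real" where
  "clamp_term R D g u = (let w = sqrt (max 0 (g * R - D\<^sup>2)); c = max (- w) (min w u) in
     D * c / g + R * (arctan (u / D) - arctan (c / D)))"

text \<open>
  The primitive is differentiable except at the two parameters where the line crosses the circle; it is
  continuous there, which is enough for the fundamental theorem of calculus.
\<close>

lemma clamp_term_has_integral:
  assumes D: "D \<noteq> 0" and g: "0 < g" and R: "0 < R"
    and q: "\<And>s. g * q s = (g * s + h)\<^sup>2 + D\<^sup>2"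
  shows "((\<lambda>s. min 1 (R / q s)) has_integral (clamp_term R D g (g + h) - clamp_term R D g h) / D) {0..1}"
proof -
  define w where "w = sqrt (max 0 (g * R - D\<^sup>2))"
  have w: "0 \<le> w" "w\<^sup>2 = max 0 (g * R - D\<^sup>2)" by (simp_all add: w_def)
  define F where "F s = clamp_term R D g (g * s + h) / D" for s
  have qpos: "0 < q s" for s
  proof -
    have "0 < g * q s" unfolding q using D by (simp add: add_nonneg_pos)
    then show ?thesis using g by (simp add: zero_less_mult_iff)
  qed
  have le: "R / q s \<le> 1 \<longleftrightarrow> g * R - D\<^sup>2 \<le> (g * s + h)\<^sup>2" for s
  proof -
    have "R / q s \<le> 1 \<longleftrightarrow> g * R \<le> g * q s" using qpos[of s] g by simp
    then show ?thesis unfolding q by linarith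
  qed
  have eq: "R / q s = R / D * (g / D) / (1 + ((g * s + h) / D)\<^sup>2)" for s
  proof -
    have "R / q s = R * g / ((g * s + h)\<^sup>2 + D\<^sup>2)"
      unfolding q[symmetric] using g by simp
    also have "\<dots> = R / D * (g / D) / (1 + ((g * s + h) / D)\<^sup>2)"
      using D by (simp add: power_divide power2_eq_square[of D] divide_simps)
    finally show ?thesis .
  qed
  have tail: "(F has_real_derivative min 1 (R / q s)) (at s)"
    if e: "e = w \<or> e = - w" and A: "open A" "s \<in> A" and out: "\<And>t. t \<in> A \<Longrightarrow> max (- w) (min w (g * t + h)) = e"
      and big: "w \<le> \<bar>g * s + h\<bar>" for e A s
  proof -
    have "w\<^sup>2 \<le> (g * s + h)\<^sup>2" using big w(1) by (metis abs_ge_zero power2_abs power_mono)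
    then have min: "min 1 (R / q s) = R / q s"
      using w(2) le[of s] by simp
    have "((\<lambda>t. (D * e / g + R * (arctan ((g * t + h) / D) - arctan (e / D))) / D)
        has_real_derivative R * (inverse (1 + ((g * s + h) / D)\<^sup>2) * (g / D)) / D) (at s)"
      using D by (auto intro!: derivative_eq_intros)
    then have "((\<lambda>t. (D * e / g + R * (arctan ((g * t + h) / D) - arctan (e / D))) / D)
        has_real_derivative min 1 (R / q s)) (at s)"
      unfolding min unfolding eq by (simp add: divide_inverse mult_ac)
    then show ?thesis
      by (rule has_field_derivative_transform_within_open[OF _ A])
        (use out in \<open>simp add: F_def clamp_term_def w_def Let_def\<close>)
  qed
  have core: "(F has_real_derivative min 1 (R / q s)) (at s)" if "\<bar>g * s + h\<bar> < w" for s
  proof -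
    have "(g * s + h)\<^sup>2 < w\<^sup>2" using that by (metis abs_ge_zero power2_abs power_strict_mono zero_less_numeral)
    then have min: "min 1 (R / q s) = 1"
      using w(2) le[of s] by (auto simp: max_def not_le split: if_splits)
    have d: "((\<lambda>t. (D * (g * t + h) / g) / D) has_real_derivative 1) (at s)"
      using D g by (auto intro!: derivative_eq_intros)
    have o: "open {t. \<bar>g * t + h\<bar> < w}"
      by (intro open_Collect_less continuous_intros)
    have e: "D * (g * t + h) / g / D = F t" if "t \<in> {t. \<bar>g * t + h\<bar> < w}" for t
    proof -
      have "max (- w) (min w (g * t + h)) = g * t + h" using that by auto
      then show ?thesis by (simp add: F_def clamp_term_def w_def[symmetric] Let_def)
    qed
    show ?thesis
      unfolding min by (rule has_field_derivative_transform_within_open[OF d o _ e]) (use that in auto)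
  qed
  have deriv: "(F has_real_derivative min 1 (R / q s)) (at s)" if "\<bar>g * s + h\<bar> \<noteq> w" for s
  proof -
    note * = \<open>\<bar>g * s + h\<bar> \<noteq> w\<close>
    consider "\<bar>g * s + h\<bar> < w" | "w < g * s + h" | "g * s + h < - w"
    proof -
      have "x < w \<and> - x < w \<or> w < x \<or> x < - w" if "\<bar>x\<bar> \<noteq> w" for x :: real
        using that by linarith
      from this[OF *] that show thesis by (auto simp: abs_less_iff)
    qed
    then show ?thesis
    proof cases
      case 1 then show ?thesis by (rule core)
    next
      case 2
      have "open {t. w < g * t + h}" by (intro open_Collect_less continuous_intros)
      with 2 w(1) show ?thesis by (intro tail[of w "{t. w < g * t + h}"]) auto
    next
      case 3
      have "open {t. g * t + h < - w}" by (intro open_Collect_less continuous_intros)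
      with 3 w(1) show ?thesis by (intro tail[of "- w" "{t. g * t + h < - w}"]) auto
    qed
  qed
  have "((\<lambda>s. min 1 (R / q s)) has_integral F 1 - F 0) {0..1}"
  proof (rule fundamental_theorem_of_calculus_interior_strong)
    show "finite {(w - h) / g, (- w - h) / g}" by simp
    show "continuous_on {0..1} F"
      unfolding F_def clamp_term_def Let_def using D g by (intro continuous_intros) auto
    fix s assume "s \<in> {0<..<1} - {(w - h) / g, (- w - h) / g}"
    then have "\<bar>g * s + h\<bar> \<noteq> w"
      using g by (auto simp: field_simps abs_if split: if_splits)
    then show "(F has_vector_derivative min 1 (R / q s)) (at s)"
      using deriv by (simp add: has_real_derivative_iff_has_vector_derivative)
  qed simp
  then show ?thesis by (simp add: F_def diff_divide_distrib add.commute)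
qed

section \<open>Winding numbers of closed polygonal curves\<close>

text \<open>
  The last equation is a default for lists without an edge.
\<close>

fun poly_path :: "complex list \<Rightarrow> real \<Rightarrow> complex" where
  "poly_path (a # b # c # ws) = linepath a b +++ poly_path (b # c # ws)"
| "poly_path [a, b] = linepath a b"
| "poly_path _ = linepath 0 0"

abbreviation chain_edge :: "complex list \<Rightarrow> nat \<Rightarrow> complex set" where
  "chain_edge ws i \<equiv> closed_segment (ws ! i) (ws ! Suc i)"

lemma poly_path_ends:
  assumes "2 \<le> length ws"
  shows "pathstart (poly_path ws) = hd ws" "pathfinish (poly_path ws) = last ws"
  using assms by (induction ws rule: poly_path.induct) auto

lemma path_poly_path: "path (poly_path ws)"
  by (induction ws rule: poly_path.induct) (simp_all add: poly_path_ends path_def[of "\<lambda>_. 0"])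

lemma path_image_poly_path:
  assumes "2 \<le> length ws"
  shows "path_image (poly_path ws) = (\<Union>i<length ws - 1. chain_edge ws i)"
  using assms
proof (induction ws rule: poly_path.induct)
  case (1 a b c ws)
  then have "path_image (poly_path (a # b # c # ws)) =
      closed_segment a b \<union> (\<Union>i<length (b # c # ws) - 1. chain_edge (b # c # ws) i)"
    by (simp add: path_image_join poly_path_ends)
  also have "\<dots> = (\<Union>i<Suc (length (b # c # ws) - 1). chain_edge (a # b # c # ws) i)"
    unfolding lessThan_Suc_eq_insert_0 by simp
  finally show ?case by simp
qed (auto simp: lessThan_Suc)

lemma winding_number_poly_path:
  assumes "2 \<le> length ws" "z \<notin> path_image (poly_path ws)"
  shows "winding_number (poly_path ws) z =
    (\<Sum>i<length ws - 1. winding_number (linepath (ws ! i) (ws ! Suc i)) z)"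
  using assms
proof (induction ws rule: poly_path.induct)
  case (1 a b c ws)
  then have "winding_number (poly_path (a # b # c # ws)) z = winding_number (linepath a b) z +
     (\<Sum>i<length (b # c # ws) - 1.
        winding_number (linepath ((b # c # ws) ! i) ((b # c # ws) ! Suc i)) z)"
    by (simp add: path_image_join poly_path_ends winding_number_join path_poly_path)
  also have "\<dots> = (\<Sum>i<Suc (length (b # c # ws) - 1).
      winding_number (linepath ((a # b # c # ws) ! i) ((a # b # c # ws) ! Suc i)) z)"
    unfolding sum.lessThan_Suc_shift by simp
  finally show ?case by simp
qed auto

text \<open>
  By induction: prepending an edge to an arc gives an arc if the edge meets it in the common endpoint
  only.
\<close>

lemma arc_poly_path:
  assumes "2 \<le> length ws" "distinct ws"
    and "\<And>i j. i < j \<Longrightarrow> Suc j < length ws \<Longrightarrow>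
           chain_edge ws i \<inter> chain_edge ws j \<subseteq> (if j = Suc i then {ws ! j} else {})"
  shows "arc (poly_path ws)"
  using assms
proof (induction ws rule: poly_path.induct)
  case (1 a b c ws)
  let ?us = "b # c # ws"
  note meet = 1(4)
  have arc: "arc (poly_path ?us)"
  proof (rule 1(1))
    show "chain_edge ?us i \<inter> chain_edge ?us j \<subseteq> (if j = Suc i then {?us ! j} else {})"
      if "i < j" "Suc j < length ?us" for i j
      using meet[of "Suc i" "Suc j"] that by (auto simp del: nth_Cons_Suc simp: nth_Cons_Suc[of _ _ "Suc _"] nth_Cons_Suc[of a])
  qed (use 1 in auto)
  have "closed_segment a b \<inter> chain_edge ?us j \<subseteq> {b}" if "j < length ?us - 1" for j
    using meet[of 0 "Suc j"] that by (auto split: if_splits)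
  then have "closed_segment a b \<inter> path_image (poly_path ?us) \<subseteq> {b}"
    by (subst path_image_poly_path) auto
  with arc 1 show ?case
    by (auto intro!: arc_join simp: poly_path_ends)
qed auto

text \<open>
  Simple polygons in the plane of complex numbers, where the Jordan curve theorem and the theory of
  winding numbers live.
\<close>

locale planar_polygon =
  fixes zs :: "complex list" and n :: nat
  defines "n \<equiv> length zs"
  assumes len: "3 \<le> n" and dist: "distinct zs"
    and meet: "\<And>i j. i < n \<Longrightarrow> j < n \<Longrightarrow> i \<noteq> j \<Longrightarrow>
      closed_segment (zs ! i) (zs ! (Suc i mod n)) \<inter> closed_segment (zs ! j) (zs ! (Suc j mod n))
        \<subseteq> {zs ! i, zs ! (Suc i mod n)} \<inter> {zs ! j, zs ! (Suc j mod n)}"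
begin

definition nxt :: "nat \<Rightarrow> complex" where "nxt i = zs ! (Suc i mod n)"

definition curve :: "complex set" where
  "curve = (\<Union>i<n. closed_segment (zs ! i) (nxt i))"

definition boundary_path :: "real \<Rightarrow> complex" where
  "boundary_path = poly_path (zs @ [hd zs])"

lemma nth_closed: "i \<le> n \<Longrightarrow> (zs @ [hd zs]) ! i = zs ! (i mod n)"
  using len hd_conv_nth[of zs] by (cases "zs = []"; cases "i = n") (auto simp: nth_append n_def)

lemma nth_closed': "i < n \<Longrightarrow> (zs @ [hd zs]) ! i = zs ! i" "i < n \<Longrightarrow> (zs @ [hd zs]) ! Suc i = nxt i"
  unfolding nxt_def by (subst nth_closed; simp)+

lemma path_image_boundary: "path_image boundary_path = curve"
  unfolding boundary_path_def curve_def using len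
  by (subst path_image_poly_path) (auto simp: n_def[symmetric] nth_closed' intro!: SUP_cong)

lemma winding_number_boundary:
  "z \<notin> curve \<Longrightarrow> winding_number boundary_path z = (\<Sum>i<n. winding_number (linepath (zs ! i) (nxt i)) z)"
  unfolding path_image_boundary[symmetric] unfolding boundary_path_def using len
  by (subst winding_number_poly_path) (auto simp: n_def[symmetric] nth_closed' intro!: sum.cong)

lemma closed_boundary: "pathfinish boundary_path = pathstart boundary_path"
  unfolding boundary_path_def using len by (simp add: poly_path_ends n_def hd_append)

text \<open>
  The boundary is the first edge joined to the chain of the remaining ones. That chain is an arc, as two
  distinct edges other than the first can only share the vertex between them, and it meets the first edge
  in its two endpoints only.
\<close>

lemma simple_path_boundary: "simple_path boundary_path"
proof -
  obtain a b c ws where zs: "zs = a # b # c # ws"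
    using len unfolding n_def by (metis Suc_le_length_iff numeral_3_eq_3)
  let ?us = "b # c # ws @ [a]"
  have us: "?us ! i = zs ! (Suc i mod n)" if "i < n" for i
    using nth_closed[of "Suc i"] that by (simp add: zs)
  have n: "n = length ?us" "n = Suc (Suc (Suc (length ws)))" by (simp_all add: n_def zs)
  have neq: "zs ! (i mod n) \<noteq> zs ! (j mod n)" if "i mod n \<noteq> j mod n" for i j
    proof -
    have "i mod n < length zs" "j mod n < length zs"
      using len unfolding n_def by (auto intro!: mod_less_divisor)
    then show ?thesis using that dist by (simp add: nth_eq_iff_index_eq)
  qed
  have e: "chain_edge ?us i = closed_segment (zs ! Suc i) (zs ! (Suc (Suc i) mod n))" if "Suc i < n" for i
    using us[of i] us[of "Suc i"] that by simp
  have arc: "arc (poly_path ?us)"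
  proof (rule arc_poly_path)
    fix i j assume ij: "i < j" "Suc j < length ?us"
    then have "chain_edge ?us i \<inter> chain_edge ?us j \<subseteq>
       {zs ! Suc i, zs ! (Suc (Suc i) mod n)} \<inter> {zs ! Suc j, zs ! (Suc (Suc j) mod n)}"
      using meet[of "Suc i" "Suc j"] by (simp only: e n(1)[symmetric])
    moreover have "zs ! Suc i \<noteq> zs ! Suc j"
      using neq[of "Suc i" "Suc j"] ij n by simp
    moreover have "zs ! Suc i \<noteq> zs ! (Suc (Suc j) mod n)"
      using neq[of "Suc i" "Suc (Suc j)"] ij n by (cases "Suc (Suc j) = n") auto
    moreover have "zs ! (Suc (Suc i) mod n) \<noteq> zs ! (Suc (Suc j) mod n)"
      using neq[of "Suc (Suc i)" "Suc (Suc j)"] ij n by (cases "Suc (Suc j) = n") auto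
    moreover have "zs ! (Suc (Suc i) mod n) \<noteq> zs ! Suc j" if "j \<noteq> Suc i"
      using neq[of "Suc (Suc i)" "Suc j"] ij n that by auto
    moreover have "?us ! j = zs ! Suc j" using us[of j] ij n by simp
    moreover have "Suc (Suc i) mod n = Suc j" if "j = Suc i"
      using ij n that by simp
    ultimately show "chain_edge ?us i \<inter> chain_edge ?us j \<subseteq> (if j = Suc i then {?us ! j} else {})"
      by auto
  qed (use dist in \<open>auto simp: zs\<close>)
  have "closed_segment a b \<inter> chain_edge ?us j \<subseteq> {a, b}" if "Suc j < n" for j
    unfolding e[OF that] using meet[of 0 "Suc j"] that n by (simp add: zs)
  then have "closed_segment a b \<inter> path_image (poly_path ?us) \<subseteq> {a, b}"
    by (subst path_image_poly_path) (use n in auto)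
  then have "simple_path (linepath a b +++ poly_path ?us)"
    using arc dist by (intro simple_path_join_loop) (auto simp: zs poly_path_ends)
  then show ?thesis unfolding boundary_path_def by (simp add: zs)
qed

lemma simple_closed_winding:
  obtains e :: real where "e = 1 \<or> e = -1"
    "\<And>z. z \<in> inside curve \<Longrightarrow> (\<Sum>i<n. winding_number (linepath (zs ! i) (nxt i)) z) = of_real e"
    "\<And>z. z \<in> outside curve \<Longrightarrow> (\<Sum>i<n. winding_number (linepath (zs ! i) (nxt i)) z) = 0"
proof -
  have out: "(\<Sum>i<n. winding_number (linepath (zs ! i) (nxt i)) z) = 0" if "z \<in> outside curve" for z
  proof -
    have "z \<notin> curve" using outside_no_overlap[of curve] that by blast
    then show ?thesis
      using winding_number_zero_in_outside[of boundary_path z] that simple_path_boundary closed_boundary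
        winding_number_boundary[of z]
      by (simp add: path_image_boundary simple_path_imp_path)
  qed
  have ins: "winding_number boundary_path z = (\<Sum>i<n. winding_number (linepath (zs ! i) (nxt i)) z)"
    if "z \<in> inside curve" for z
    using winding_number_boundary[of z] that by (simp add: inside_def)
  show thesis
  proof (rule simple_closed_path_winding_number_inside[OF simple_path_boundary])
    assume "\<And>z. z \<in> inside (path_image boundary_path) \<Longrightarrow> winding_number boundary_path z = 1"
    then show thesis
      by (intro that[of 1]) (simp_all add: path_image_boundary ins[symmetric] out)
  next
    assume "\<And>z. z \<in> inside (path_image boundary_path) \<Longrightarrow> winding_number boundary_path z = - 1"
    then show thesis
      by (intro that[of "-1"]) (simp_all add: path_image_boundary ins[symmetric] out)
  qed
qed

end

section \<open>A polygon as a signed sum of triangles\<close>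

lemma interior_wedge_degenerate:
  assumes "cdet a b = 0"
  shows "interior (wedge a b) = {}"
proof (cases "a = 0")
  case True
  have "card {0, b} \<le> 2" by (simp add: card_insert_if)
  then show ?thesis
    unfolding wedge_def True by (simp add: empty_interior_convex_hull del: card_insert_disjoint)
next
  case False
  have "wedge a b \<subseteq> {z. (\<i> * a) \<bullet> z = 0}"
  proof
    fix z assume "z \<in> wedge a b"
    then obtain u v where "z = u *\<^sub>R a + v *\<^sub>R b"
      unfolding wedge_def convex_hull_3_alt by auto
    then have "(\<i> * a) \<bullet> z = v * cdet a b"
      by (simp add: inner_complex_def cdet_def algebra_simps)
    with assms show "z \<in> {z. (\<i> * a) \<bullet> z = 0}" by simp
  qed
  moreover have "interior {z. (\<i> * a) \<bullet> z = 0} = {}"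
    using False by (intro interior_hyperplane) simp
  ultimately show ?thesis
    using interior_mono by blast
qed

text \<open>
  The left-hand side is the winding number of the closed path \<open>0 \<rightarrow> a \<rightarrow> b \<rightarrow> 0\<close>, written so that the spokes
  from \<open>0\<close> cancel when the formula is summed along a closed polygon.
\<close>

lemma winding_number_triangle_wedge:
  assumes "z \<notin> closed_segment 0 a" "z \<notin> closed_segment a b" "z \<notin> closed_segment 0 b"
  shows "winding_number (linepath 0 a) z + winding_number (linepath a b) z - winding_number (linepath 0 b) z
    = of_real (sgn (cdet a b) * indicator (wedge a b) z)"
proof -
  have z: "z \<notin> closed_segment b 0" using assms by (simp add: closed_segment_commute)
  let ?g = "linepath 0 a +++ linepath a b +++ linepath b 0"
  have "winding_number (linepath b 0) z = - winding_number (linepath 0 b) z"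
    using winding_number_reversepath[of "linepath 0 b" z] assms by simp
  then have "winding_number ?g z = winding_number (linepath 0 a) z + winding_number (linepath a b) z
      - winding_number (linepath 0 b) z"
    using assms z by (simp add: winding_number_join path_image_join)
  moreover have "winding_number ?g z = of_real (sgn (cdet a b) * indicator (wedge a b) z)"
  proof (cases "z \<in> wedge a b")
    case False
    have "closed_segment 0 a \<union> closed_segment a b \<union> closed_segment b 0 \<subseteq> wedge a b"
      unfolding wedge_def by (intro Un_least closed_segment_subset convex_convex_hull) (simp_all add: hull_inc)
    then have "winding_number ?g z = 0"
      using False by (intro winding_number_zero_outside[of _ "wedge a b"])
        (auto simp: path_image_join wedge_def)
    with False show ?thesis by simp
  next
    case True
    then have int: "z \<in> interior (convex hull {0, a, b})"
      using assms z by (subst interior_of_triangle) (auto simp: wedge_def)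
    obtain u v where uv: "0 \<le> u" "0 \<le> v" "u + v \<le> 1" "z = u *\<^sub>R a + v *\<^sub>R b"
      using True unfolding wedge_def convex_hull_3_alt by auto
    \<comment> \<open>otherwise \<open>z\<close> would lie on the side from \<open>0\<close> to \<open>a\<close>; this decides the orientation below\<close>
    have "v \<noteq> 0"
    proof
      assume "v = 0"
      then have "z \<in> closed_segment 0 a"
        using uv by (auto simp: closed_segment_def intro!: exI[of _ u])
      with assms show False by simp
    qed
    have "cdet a b \<noteq> 0"
      using int interior_wedge_degenerate[of a b] by (auto simp: wedge_def)
    have "Im ((a - 0) * cnj (a - z)) = v * cdet a b"
      by (simp add: uv cdet_def algebra_simps)
    then show ?thesis
      using winding_number_triangle[OF int] True \<open>v \<noteq> 0\<close> uv \<open>cdet a b \<noteq> 0\<close>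
      by (auto simp: zero_less_mult_iff sgn_if)
  qed
  ultimately show ?thesis by simp
qed

lemma sum_cyclic_shift:
  assumes "0 < (n::nat)"
  shows "(\<Sum>i<n. f (Suc i mod n)) = (\<Sum>i<n. f i)"
proof -
  obtain m where n: "n = Suc m" using assms gr0_implies_Suc by blast
  have "(\<Sum>i<Suc m. f (Suc i mod Suc m)) = (\<Sum>i<m. f (Suc i)) + f 0"
    by (simp add: sum.lessThan_Suc)
  also have "\<dots> = (\<Sum>i<Suc m. f i)"
    unfolding sum.lessThan_Suc_shift by (simp add: add.commute)
  finally show ?thesis by (simp add: n)
qed

lemma closed_segment_null_sets: "closed_segment a b \<in> null_sets (lborel :: complex measure)"
proof -
  have "interior (closed_segment a b) = {}"
    by (rule interior_closed_segment_ge2) simp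
  then have "negligible (closed_segment a b)"
    using negligible_convex_frontier[of "closed_segment a b"] by (simp add: frontier_def)
  then show ?thesis
    by (simp add: negligible_iff_null_sets null_sets_completion_iff)
qed

lemma compact_wedge: "compact (wedge a b)"
  unfolding wedge_def by (intro finite_imp_compact_convex_hull) simp

context planar_polygon
begin

definition region :: "complex set" where
  "region = curve \<union> inside curve"

lemma compact_curve: "compact curve"
  unfolding curve_def by (intro compact_UN) auto

lemma compact_region: "compact region"
  unfolding compact_eq_bounded_closed region_def path_image_boundary[symmetric]
  using closed_path_image_Un_inside[of boundary_path] simple_path_boundary
  by (auto simp: simple_path_imp_path bounded_path_image bounded_inside)

lemma open_inside_curve: "open (inside curve)"
  by (simp add: compact_curve compact_imp_closed open_inside)

lemma sum_nxt: "(\<Sum>i<n. f (nxt i)) = (\<Sum>i<n. f (zs ! i))"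
  unfolding nxt_def using sum_cyclic_shift[of n "\<lambda>i. f (zs ! i)"] len by simp

text \<open>
  Around points off the curve and off the spokes, both sides are the winding number of the boundary times
  \<open>e\<close>, where \<open>e\<close> is the sense in which the boundary is traversed.
\<close>

lemma region_signed_wedges:
  obtains e :: real where "e = 1 \<or> e = -1"
    "\<And>z. z \<notin> curve \<Longrightarrow> (\<And>i. i < n \<Longrightarrow> z \<notin> closed_segment 0 (zs ! i)) \<Longrightarrow>
      indicator region z = e * (\<Sum>i<n. sgn (cdet (zs ! i) (nxt i)) * indicator (wedge (zs ! i) (nxt i)) z)"
proof -
  have fan: "of_real (\<Sum>i<n. sgn (cdet (zs ! i) (nxt i)) * indicator (wedge (zs ! i) (nxt i)) z) =
      (\<Sum>i<n. winding_number (linepath (zs ! i) (nxt i)) z)"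
    if "z \<notin> curve" "\<And>i. i < n \<Longrightarrow> z \<notin> closed_segment 0 (zs ! i)" for z
  proof -
    have "of_real (\<Sum>i<n. sgn (cdet (zs ! i) (nxt i)) * indicator (wedge (zs ! i) (nxt i)) z) =
      (\<Sum>i<n. winding_number (linepath 0 (zs ! i)) z + winding_number (linepath (zs ! i) (nxt i)) z
         - winding_number (linepath 0 (nxt i)) z)"
      unfolding of_real_sum
    proof (rule sum.cong[OF refl], rule winding_number_triangle_wedge[symmetric])
      fix i assume i: "i \<in> {..<n}"
      show "z \<notin> closed_segment 0 (zs ! i)" "z \<notin> closed_segment 0 (nxt i)"
        using that(2) i len unfolding nxt_def by auto
      show "z \<notin> closed_segment (zs ! i) (nxt i)"
        using that(1) i unfolding curve_def by auto
    qed
    also have "\<dots> = (\<Sum>i<n. winding_number (linepath (zs ! i) (nxt i)) z)"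
      by (simp add: sum_subtractf sum.distrib sum_nxt[of "\<lambda>w. winding_number (linepath 0 w) z"])
    finally show ?thesis .
  qed
  obtain e :: real where e: "e = 1 \<or> e = -1"
    and ins: "\<And>z. z \<in> inside curve \<Longrightarrow> (\<Sum>i<n. winding_number (linepath (zs ! i) (nxt i)) z) = of_real e"
    and out: "\<And>z. z \<in> outside curve \<Longrightarrow> (\<Sum>i<n. winding_number (linepath (zs ! i) (nxt i)) z) = 0"
    using simple_closed_winding by blast
  show thesis
  proof (rule that[OF e])
    fix z assume z: "z \<notin> curve" "\<And>i. i < n \<Longrightarrow> z \<notin> closed_segment 0 (zs ! i)"
    consider "z \<in> inside curve" | "z \<in> outside curve" "z \<notin> inside curve"
      using z(1) inside_Un_outside[of curve] by blast
    then have "(\<Sum>i<n. sgn (cdet (zs ! i) (nxt i)) * indicator (wedge (zs ! i) (nxt i)) z)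
        = e * indicator region z"
    proof cases
      case 1
      then show ?thesis
        using fan[OF z] ins[OF 1] by (simp add: region_def del: of_real_sum)
    next
      case 2
      then show ?thesis
        using fan[OF z] out[OF 2(1)] z(1) by (simp add: region_def del: of_real_sum)
    qed
    then show "indicator region z =
        e * (\<Sum>i<n. sgn (cdet (zs ! i) (nxt i)) * indicator (wedge (zs ! i) (nxt i)) z)"
      using e by auto
  qed
qed

lemma measure_region_signed_wedges:
  obtains e :: real where "e = 1 \<or> e = -1"
    "\<And>K. compact K \<Longrightarrow> measure lborel (region \<inter> K) =
      e * (\<Sum>i<n. sgn (cdet (zs ! i) (nxt i)) * measure lborel (wedge (zs ! i) (nxt i) \<inter> K))"
proof -
  obtain e :: real where e: "e = 1 \<or> e = -1"
    and wedges: "\<And>z. z \<notin> curve \<Longrightarrow> (\<And>i. i < n \<Longrightarrow> z \<notin> closed_segment 0 (zs ! i)) \<Longrightarrow>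
      indicator region z = e * (\<Sum>i<n. sgn (cdet (zs ! i) (nxt i)) * indicator (wedge (zs ! i) (nxt i)) z)"
    using region_signed_wedges by blast
  define N0 where "N0 = curve \<union> (\<Union>i<n. closed_segment 0 (zs ! i))"
  have N0: "N0 \<in> null_sets lborel"
    unfolding N0_def curve_def
    by (intro null_sets.Un null_sets_UN' closed_segment_null_sets) auto
  show thesis
  proof (rule that[OF e])
    fix K :: "complex set" assume K: "compact K"
    have mK: "K \<in> sets borel" by (simp add: K borel_compact)
    have int: "integrable lborel (indicator (wedge a b \<inter> K) :: complex \<Rightarrow> real)" for a b
      using compact_wedge[of a b] K
      by (intro integrable_real_indicator emeasure_bounded_finite)
        (auto intro!: borel_compact compact_imp_bounded compact_Int)
    have "measure lborel (region \<inter> K) = (\<integral>z. indicator (region \<inter> K) z \<partial>lborel)"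
      by simp
    also have "\<dots> = (\<integral>z. e * (\<Sum>i<n. sgn (cdet (zs ! i) (nxt i)) *
        indicator (wedge (zs ! i) (nxt i) \<inter> K) z) \<partial>lborel)"
    proof (rule integral_cong_AE)
      show "AE z in lborel. indicator (region \<inter> K) z =
          e * (\<Sum>i<n. sgn (cdet (zs ! i) (nxt i)) * indicator (wedge (zs ! i) (nxt i) \<inter> K) z)"
      proof (rule AE_I'[OF N0], rule subsetI, rule ccontr)
        fix z assume z: "z \<in> {z \<in> space lborel. indicator (region \<inter> K) z \<noteq>
          e * (\<Sum>i<n. sgn (cdet (zs ! i) (nxt i)) * indicator (wedge (zs ! i) (nxt i) \<inter> K) z)}" "z \<notin> N0"
        then show False
          using wedges[of z] by (cases "z \<in> K") (auto simp: N0_def indicator_inter_arith)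
      qed
      show "indicator (region \<inter> K) \<in> borel_measurable lborel"
        using borel_compact[OF compact_region] mK by simp
      show "(\<lambda>z. e * (\<Sum>i<n. sgn (cdet (zs ! i) (nxt i)) *
          indicator (wedge (zs ! i) (nxt i) \<inter> K) z)) \<in> borel_measurable lborel"
        using int by (intro borel_measurable_times borel_measurable_sum borel_measurable_const)
          (auto dest: borel_measurable_integrable)
    qed
    also have "\<dots> = e * (\<Sum>i<n. sgn (cdet (zs ! i) (nxt i)) * measure lborel (wedge (zs ! i) (nxt i) \<inter> K))"
      unfolding integral_mult_right_zero
      using int by (subst Bochner_Integration.integral_sum) (auto intro!: integrable_mult_right)
    finally show "measure lborel (region \<inter> K) =
      e * (\<Sum>i<n. sgn (cdet (zs ! i) (nxt i)) * measure lborel (wedge (zs ! i) (nxt i) \<inter> K))" .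
  qed
qed

text \<open>
  The inside of a Jordan curve is open and nonempty.
\<close>

lemma measure_region_pos: "0 < measure lborel region"
proof -
  have "inside curve \<noteq> {}"
    using Jordan_inside_outside[OF simple_path_boundary closed_boundary]
    by (simp add: path_image_boundary)
  then have "\<not> negligible (inside curve)"
    using open_inside_curve open_not_negligible by blast
  then have "emeasure lborel (inside curve) \<noteq> 0"
    using open_inside_curve
    by (auto simp: negligible_iff_null_sets null_sets_completion_iff null_sets_def)
  moreover have "emeasure lborel (inside curve) \<le> emeasure lborel region"
    using compact_region by (intro emeasure_mono) (auto simp: region_def borel_compact)
  ultimately have "0 < emeasure lborel region" using zero_less_iff_neq_zero by fastforce
  moreover have "emeasure lborel region < \<infinity>"
    using emeasure_bounded_finite[OF compact_imp_bounded[OF compact_region]] by simp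
  ultimately show ?thesis
    by (simp add: measure_def enn2real_positive_iff top.not_eq_extremum)
qed

end

lemma wedge_subset_cball:
  assumes "norm a \<le> r" "norm b \<le> r"
  shows "wedge a b \<subseteq> cball 0 r"
proof -
  have "0 \<le> r" using assms(1) norm_ge_zero order_trans by blast
  then show ?thesis
    unfolding wedge_def using assms by (intro hull_minimal) auto
qed

lemma segment_subset_wedge: "0 \<le> s \<Longrightarrow> s \<le> 1 \<Longrightarrow> a + s *\<^sub>R (b - a) \<in> wedge a b"
  unfolding wedge_def convex_hull_3_alt
  by (intro CollectI exI[of _ "1 - s"] exI[of _ s]) (simp add: algebra_simps)

text \<open>
  A disc that contains the triangle makes the integrand in \<open>measure_wedge_disc_integral\<close> equal to \<open>1\<close>.
\<close>

lemma signed_measure_wedge: "sgn (cdet a b) * measure lborel (wedge a b) = cdet a b / 2"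
proof (cases "cdet a b = 0")
  case False
  define r where "r = max (norm a) (norm b)"
  have r: "wedge a b \<subseteq> cball 0 r" "0 \<le> r"
    unfolding r_def by (intro wedge_subset_cball) (auto simp: le_max_iff_disj)
  have "((\<lambda>s. min 1 (r\<^sup>2 / (norm (a + s *\<^sub>R (b - a)))\<^sup>2)) has_integral 1) {0..1}"
  proof (rule has_integral_eq)
    show "((\<lambda>_. 1 :: real) has_integral 1) {0..1 :: real}"
      using has_integral_const_real[of "1 :: real" 0 1] by simp
    fix s :: real assume s: "s \<in> {0..1}"
    define \<rho> where "\<rho> = norm (a + s *\<^sub>R (b - a))"
    have "0 < \<rho>" using cdet_nonzero_segment[OF False] by (simp add: \<rho>_def)
    moreover have "\<rho> \<le> r"
      using r(1) segment_subset_wedge[of s a b] s by (auto simp: \<rho>_def)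
    then have "\<rho>\<^sup>2 \<le> r\<^sup>2" using \<open>0 < \<rho>\<close> by (intro power_mono) auto
    ultimately show "1 = min 1 (r\<^sup>2 / (norm (a + s *\<^sub>R (b - a)))\<^sup>2)"
      unfolding \<rho>_def[symmetric] by (simp add: min_def)
  qed
  from measure_wedge_disc_integral[OF False r(2) this] have "measure lborel (wedge a b) = \<bar>cdet a b\<bar> / 2"
    using r(1) by (simp add: Int_absorb2)
  then have "sgn (cdet a b) * measure lborel (wedge a b) = (sgn (cdet a b) * \<bar>cdet a b\<bar>) / 2"
    by simp
  then show ?thesis by (simp only: sgn_mult_abs)
qed simp

text \<open>
  Twice the signed area that an edge contributes to the intersection with the disc. Apart from \<open>D\<close> it
  depends only on inner products with \<open>b - a\<close>, hence it can be evaluated for vectors relative to any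
  point of the perpendicular to the plane at the centre of the disc.
\<close>

definition edge_term :: "real \<Rightarrow> real \<Rightarrow> 'a::real_inner \<Rightarrow> 'a \<Rightarrow> real" where
  "edge_term R D a b = (if D = 0 then 0 else
     clamp_term R D ((b - a) \<bullet> (b - a)) (b \<bullet> (b - a)) - clamp_term R D ((b - a) \<bullet> (b - a)) (a \<bullet> (b - a)))"

lemma signed_measure_wedge_disc:
  assumes r: "0 < r"
  shows "sgn (cdet a b) * measure lborel (wedge a b \<inter> cball 0 r) = edge_term (r\<^sup>2) (cdet a b) a b / 2"
proof (cases "cdet a b = 0")
  case True
  then show ?thesis by (simp add: edge_term_def)
next
  case False
  define D where "D = cdet a b"
  define g where "g = (b - a) \<bullet> (b - a)"
  define h where "h = a \<bullet> (b - a)"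
  define F where "F = clamp_term (r\<^sup>2) D g"
  have "a \<noteq> b" using False by (auto simp: cdet_def)
  then have g: "0 < g" by (simp add: g_def)
  have q: "g * (norm (a + s *\<^sub>R (b - a)))\<^sup>2 = (g * s + h)\<^sup>2 + D\<^sup>2" for s
    unfolding g_def h_def D_def cdet_def power2_norm_eq_inner inner_complex_def
    by (simp add: power2_eq_square algebra_simps)
  have "((\<lambda>s. min 1 (r\<^sup>2 / (norm (a + s *\<^sub>R (b - a)))\<^sup>2)) has_integral (F (g + h) - F h) / D) {0..1}"
    unfolding F_def using False g r q by (intro clamp_term_has_integral) (simp_all add: D_def)
  from measure_wedge_disc_integral[OF False less_imp_le[OF r] this]
  have m: "measure lborel (wedge a b \<inter> cball 0 r) = \<bar>D\<bar> * ((F (g + h) - F h) / D) / 2"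
    by (simp add: D_def)
  have "sgn D * measure lborel (wedge a b \<inter> cball 0 r) = (sgn D * \<bar>D\<bar>) * ((F (g + h) - F h) / D) / 2"
    unfolding m by simp
  also have "\<dots> = (F (g + h) - F h) / 2"
    using False by (simp add: sgn_mult_abs D_def)
  also have "g + h = b \<bullet> (b - a)"
    by (simp add: g_def h_def inner_diff_left)
  finally show ?thesis
    using False by (simp add: edge_term_def D_def F_def g_def h_def)
qed

context planar_polygon
begin

lemma region_area_formula:
  obtains e :: real where "e = 1 \<or> e = -1"
    "measure lborel region = e * (\<Sum>i<n. cdet (zs ! i) (nxt i)) / 2"
    "\<And>r. 0 < r \<Longrightarrow> measure lborel (region \<inter> cball 0 r) =
       e * (\<Sum>i<n. edge_term (r\<^sup>2) (cdet (zs ! i) (nxt i)) (zs ! i) (nxt i)) / 2"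
proof -
  obtain e :: real where e: "e = 1 \<or> e = -1" and *: "\<And>K. compact K \<Longrightarrow> measure lborel (region \<inter> K) =
      e * (\<Sum>i<n. sgn (cdet (zs ! i) (nxt i)) * measure lborel (wedge (zs ! i) (nxt i) \<inter> K))"
    using measure_region_signed_wedges by blast
  show thesis
  proof (rule that[OF e])
    \<comment> \<open>large enough to cut nothing off\<close>
    define K where "K = region \<union> (\<Union>i<n. wedge (zs ! i) (nxt i))"
    have K: "compact K"
      unfolding K_def by (intro compact_Un compact_region compact_UN compact_wedge) auto
    have "measure lborel region = measure lborel (region \<inter> K)"
      by (simp add: K_def Int_absorb2)
    also have "\<dots> = e * (\<Sum>i<n. sgn (cdet (zs ! i) (nxt i)) * measure lborel (wedge (zs ! i) (nxt i) \<inter> K))"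
      using K by (rule *)
    also have "(\<Sum>i<n. sgn (cdet (zs ! i) (nxt i)) * measure lborel (wedge (zs ! i) (nxt i) \<inter> K))
        = (\<Sum>i<n. cdet (zs ! i) (nxt i) / 2)"
    proof (rule sum.cong[OF refl])
      fix i assume "i \<in> {..<n}"
      then have "wedge (zs ! i) (nxt i) \<inter> K = wedge (zs ! i) (nxt i)" by (auto simp: K_def)
      then show "sgn (cdet (zs ! i) (nxt i)) * measure lborel (wedge (zs ! i) (nxt i) \<inter> K)
          = cdet (zs ! i) (nxt i) / 2" by (simp add: signed_measure_wedge)
    qed
    finally show "measure lborel region = e * (\<Sum>i<n. cdet (zs ! i) (nxt i)) / 2"
      by (simp add: sum_divide_distrib[symmetric])
    show "measure lborel (region \<inter> cball 0 r) =
       e * (\<Sum>i<n. edge_term (r\<^sup>2) (cdet (zs ! i) (nxt i)) (zs ! i) (nxt i)) / 2" if "0 < r" for r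
      using that by (simp add: * signed_measure_wedge_disc sum_divide_distrib[symmetric])
  qed
qed

end

lemma clamp_term_minus: "clamp_term R (- D) g u = - clamp_term R D g u"
  by (simp add: clamp_term_def Let_def arctan_minus algebra_simps)

lemma edge_term_sign: "e = 1 \<or> e = -1 \<Longrightarrow> edge_term R (e * D) a b = e * edge_term R D a b"
  by (auto simp: edge_term_def clamp_term_minus)

section \<open>From the plane of complex numbers to a plane in space\<close>

locale plane_frame =
  fixes H :: "point set" and C e1 e2 :: point
  assumes orthonormal: "e1 \<bullet> e1 = 1" "e2 \<bullet> e2 = 1" "e1 \<bullet> e2 = 0"
    and range_frame: "H = range (\<lambda>z. C + Re z *\<^sub>R e1 + Im z *\<^sub>R e2)"
begin

definition frame :: "complex \<Rightarrow> point" where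
  "frame z = C + Re z *\<^sub>R e1 + Im z *\<^sub>R e2"

lemma inner_frame: "(frame x - C) \<bullet> (frame y - C) = x \<bullet> y"
  using orthonormal
  by (simp add: frame_def inner_complex_def inner_commute[of e2 e1] algebra_simps inner_add_left inner_add_right)

lemma dist_frame: "dist (frame x) (frame y) = dist x y"
proof -
  have "frame x - frame y = frame (x - y) - C" by (simp add: frame_def algebra_simps)
  then have "(norm (frame x - frame y))\<^sup>2 = (norm (x - y))\<^sup>2"
    using inner_frame[of "x - y" "x - y"] by (simp add: power2_norm_eq_inner)
  then show ?thesis by (simp add: dist_norm)
qed

lemma inj_frame: "inj frame"
  by (metis dist_eq_0_iff dist_frame injI)

lemma range_frame': "range frame = H"
  unfolding frame_def range_frame ..

lemma continuous_frame: "continuous_on S frame"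
  unfolding frame_def by (intro continuous_intros)

lemma measurable_frame [measurable]: "frame \<in> borel_measurable borel"
  by (intro borel_measurable_continuous_onI continuous_frame)

lemma plane_area_frame: "plane_area H = distr lborel borel frame"
proof -
  define g where "g = inv complex_vec"
  have g: "complex_vec (g x) = x" "g (complex_vec z) = z" for x z
    using bij_complex_vec by (simp_all add: g_def bij_is_surj bij_is_inj surj_f_inv_f)
  have norm: "norm (complex_vec z) = norm z" for z
    by (simp add: norm_vec_def L2_set_def UNIV_2 cmod_def)
  have "dist (complex_vec x) (complex_vec y) = dist x y" for x y
    using norm[of "x - y"] by (simp add: dist_norm linear_diff[OF linear_complex_vec])
  from this[of "g x" "g y" for x y] have "dist (g x) (g y) = dist x y" for x y
    by (simp add: g(1))
  moreover have "range (frame \<circ> g) = H"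
    unfolding image_comp[symmetric] surjI[of g complex_vec, OF g(2)] by (rule range_frame')
  ultimately have "plane_isometry H (frame \<circ> g)"
    unfolding plane_isometry_def by (simp add: dist_frame)
  then have "plane_area H = distr lborel borel (frame \<circ> g)"
    by (rule plane_area_eq)
  also have "\<dots> = distr (distr lborel borel complex_vec) borel (frame \<circ> g)"
    by (simp add: distr_complex_vec)
  also have "\<dots> = distr lborel borel ((frame \<circ> g) \<circ> complex_vec)"
    using plane_isometry_measurable[OF \<open>plane_isometry H (frame \<circ> g)\<close>] by (intro distr_distr) auto
  also have "(frame \<circ> g) \<circ> complex_vec = frame"
    using g by auto
  finally show ?thesis .
qed

lemma measure_frame_image:
  assumes "compact S"
  shows "emeasure (plane_area H) (frame ` S) = emeasure lborel S"
    "measure (plane_area H) (frame ` S) = measure lborel S"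
proof -
  have "compact (frame ` S)"
    using assms by (intro compact_continuous_image continuous_frame)
  then show "emeasure (plane_area H) (frame ` S) = emeasure lborel S"
    unfolding plane_area_frame
    by (subst emeasure_distr) (auto simp: borel_compact inj_vimage_image_eq inj_frame)
  then show "measure (plane_area H) (frame ` S) = measure lborel S"
    by (simp add: measure_def)
qed

lemma frame_closed_segment: "frame ` closed_segment x y = closed_segment (frame x) (frame y)"
proof -
  have "frame ((1 - u) *\<^sub>R x + u *\<^sub>R y) = (1 - u) *\<^sub>R frame x + u *\<^sub>R frame y" for u
    by (simp add: frame_def algebra_simps)
  then show ?thesis
    unfolding closed_segment_def by (fastforce simp: image_iff)
qed

text \<open>
  The frame is an isometry onto the plane, so it transports the bounded complementary components of the
  curve.
\<close>

lemma frame_bounded_component: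
  assumes "z \<notin> S"
  shows "bounded (connected_component_set (H - frame ` S) (frame z)) \<longleftrightarrow>
    bounded (connected_component_set (- S) z)"
proof -
  have inv: "frame (inv frame y) = y" if "y \<in> H" for y
    using that by (simp add: f_inv_into_f range_frame')
  have "homeomorphism (- S) (H - frame ` S) frame (inv frame)"
  proof (rule homeomorphismI)
    show "continuous_on (- S) frame" by (rule continuous_frame)
    have "dist (inv frame x) (inv frame y) = dist x y" if "x \<in> H" "y \<in> H" for x y
      using dist_frame[of "inv frame x" "inv frame y"] that by (simp add: inv)
    then have "continuous_on H (inv frame)"
      unfolding continuous_on_iff by metis
    then show "continuous_on (H - frame ` S) (inv frame)"
      by (rule continuous_on_subset) blast
    show "frame ` (- S) \<subseteq> H - frame ` S"
      using range_frame' by (auto dest: injD[OF inj_frame])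
    show "inv frame ` (H - frame ` S) \<subseteq> - S"
    proof clarify
      fix y assume "y \<in> H" "y \<notin> frame ` S" "inv frame y \<in> S"
      then show False using inv[of y] by (metis imageI)
    qed
    show "inv frame (frame x) = x" for x by (simp add: inj_frame)
    show "frame (inv frame y) = y" if "y \<in> H - frame ` S" for y
      using that by (simp add: inv)
  qed
  then have "connected_component_set (H - frame ` S) (frame z) = frame ` connected_component_set (- S) z"
    using assms by (intro connected_component_set_homeomorphism) auto
  moreover have "bounded (frame ` T) \<longleftrightarrow> bounded T" for T
    unfolding bounded_two_points by (simp add: dist_frame)
  ultimately show ?thesis by simp
qed

end

unbundle cross3_syntax

lemma plane_frame_exists:
  assumes "plane H"
  obtains C e1 e2 where "plane_frame H C e1 e2" "(P - C) \<bullet> e1 = 0" "(P - C) \<bullet> e2 = 0"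
proof -
  have aff: "affine H" and dim: "aff_dim H = 2"
    using assms by (auto simp: plane_def)
  have "H \<noteq> {}" using dim by auto
  then obtain a where a: "a \<in> H" by blast
  define V where "V = (\<lambda>x. x - a) ` H"
  have V: "subspace V"
    unfolding V_def by (rule affine_diffs_subspace_subtract[OF aff a])
  have "int (dim V) = 2"
    using aff_dim_translation_eq_subtract[of a H] aff_dim_subspace[OF V] dim unfolding V_def by simp
  then have "dim V = 2" by simp
  with orthonormal_basis_subspace[OF V] obtain B where B: "pairwise orthogonal B"
    "\<And>x. x \<in> B \<Longrightarrow> norm x = 1" "card B = 2" "span B = V"
    by metis
  from B(3) obtain e1 e2 where e: "B = {e1, e2}" "e1 \<noteq> e2"
    by (meson card_2_iff)
  have on: "e1 \<bullet> e1 = 1" "e2 \<bullet> e2 = 1" "e1 \<bullet> e2 = 0" "e2 \<bullet> e1 = 0"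
    using B(1,2) e by (auto simp: pairwise_def orthogonal_def dot_square_norm)
  define s t where "s = (P - a) \<bullet> e1" and "t = (P - a) \<bullet> e2"
  define C where "C = a + s *\<^sub>R e1 + t *\<^sub>R e2"
  have H: "x \<in> H \<longleftrightarrow> x - a \<in> span {e1, e2}" for x
    using B(4) e(1) by (auto simp: V_def)
  have span: "y \<in> span {e1, e2} \<longleftrightarrow> (\<exists>u v. y = u *\<^sub>R e1 + v *\<^sub>R e2)" for y
    by (auto simp: span_breakdown_eq algebra_simps) 
  have "H = range (\<lambda>z. C + Re z *\<^sub>R e1 + Im z *\<^sub>R e2)"
  proof (intro set_eqI iffI)
    fix x assume "x \<in> H"
    then obtain u v where "x - a = u *\<^sub>R e1 + v *\<^sub>R e2" unfolding H span by blast
    then have "x = (\<lambda>z. C + Re z *\<^sub>R e1 + Im z *\<^sub>R e2) (Complex (u - s) (v - t))"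
      by (simp add: C_def algebra_simps)
    then show "x \<in> range (\<lambda>z. C + Re z *\<^sub>R e1 + Im z *\<^sub>R e2)" by (rule range_eqI)
  next
    fix x assume "x \<in> range (\<lambda>z. C + Re z *\<^sub>R e1 + Im z *\<^sub>R e2)"
    then obtain z where "x = C + Re z *\<^sub>R e1 + Im z *\<^sub>R e2" by blast
    then have "x - a = (s + Re z) *\<^sub>R e1 + (t + Im z) *\<^sub>R e2"
      by (simp add: C_def algebra_simps)
    then show "x \<in> H" unfolding H span by blast
  qed
  then have "plane_frame H C e1 e2"
    using on by unfold_locales
  moreover have "(P - C) \<bullet> e1 = 0" "(P - C) \<bullet> e2 = 0"
    using on by (simp_all add: C_def s_def t_def inner_diff_left inner_add_left)
  ultimately show thesis by (rule that)
qed

definition doubled_vector_area :: "point \<Rightarrow> point list \<Rightarrow> point" where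
  "doubled_vector_area P vs =
     (\<Sum>i<length vs. (vs ! i - P) \<times> (vs ! (Suc i mod length vs) - P))"

text \<open>
  Choose the origin of the frame at the foot \<open>C\<close> of the perpendicular from \<open>P\<close>, with unit normal
  \<open>m = e1 \<times> e2\<close>. Then \<open>C - P = \<kappa> m\<close>, and for points \<open>x\<close>, \<open>y\<close> of the plane the product \<open>(x - P) \<times> (y - P)\<close> is
  \<open>det (x - C, y - C) m\<close> plus terms that cancel along a closed polygon. So \<open>N\<close> is \<open>m\<close> times the sum
  of the determinants, which is twice the area up to the orientation \<open>e\<close>: normalizing \<open>N\<close> yields \<open>e m\<close>, and
  inner products with it yield \<open>e \<kappa>\<close> for \<open>h\<close> and the determinants multiplied by \<open>e\<close>.
\<close>

lemma polygon_region_disc_area: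
  fixes H :: "point set" and vs :: "point list" and P :: point and d :: real
  assumes "plane H" and in_H: "set vs \<subseteq> H" and simple: "simple_polygon vs" and d: "0 \<le> d"
  defines "N \<equiv> doubled_vector_area P vs"
  defines "h \<equiv> N \<bullet> (vs ! 0 - P) / norm N"
  defines "R \<equiv> d\<^sup>2 - h\<^sup>2"
  defines "S \<equiv> polygon_region H vs"
  shows "0 < norm N" "compact S"
    "emeasure (plane_area H) S = ennreal (norm N / 2)"
    "measure (plane_area H) (S \<inter> cball P d) = (if R \<le> 0 then 0 else
       (\<Sum>i<length vs. let a = vs ! i - P; b = vs ! (Suc i mod length vs) - P in
          edge_term R (N \<bullet> (a \<times> b) / norm N) a b) / 2)"
proof -
  obtain C e1 e2 where "plane_frame H C e1 e2" and PC: "(P - C) \<bullet> e1 = 0" "(P - C) \<bullet> e2 = 0"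
    using plane_frame_exists[OF \<open>plane H\<close>, where P = P] by blast
  interpret plane_frame H C e1 e2 by fact
  define k where "k = C - P"
  define m where "m = e1 \<times> e2"
  have k: "k \<bullet> e1 = 0" "k \<bullet> e2 = 0"
    using PC by (simp_all add: k_def inner_diff_left)
  have mm: "m \<bullet> m = 1"
    unfolding m_def dot_cross using orthonormal by simp
  define \<kappa> where "\<kappa> = k \<bullet> m"
  \<comment> \<open>by Lagrange's formula, a vector orthogonal to \<open>e1\<close> and \<open>e2\<close> is parallel to \<open>m\<close>\<close>
  have km: "k = \<kappa> *\<^sub>R m"
  proof -
    have "k \<times> m = 0"
      unfolding m_def Lagrange by (simp add: k)
    then have "m \<times> (k \<times> m) = 0" by simp
    then show ?thesis
      unfolding Lagrange by (simp add: mm \<kappa>_def inner_commute)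
  qed
  define zs where "zs = map (inv frame) vs"
  define n where "n = length vs"
  then have lvs: "length vs = n" by simp
  have len: "length zs = n" and n3: "3 \<le> n"
    using simple by (simp_all add: zs_def n_def simple_polygon_def)
  have vs: "vs ! i = frame (zs ! i)" if "i < n" for i
  proof -
    have "vs ! i \<in> range frame"
      using in_H that nth_mem[of i vs] by (auto simp: n_def range_frame')
    then show ?thesis using that by (simp add: zs_def n_def f_inv_into_f)
  qed
  have mod: "Suc i mod n < n" for i using n3 by simp
  have edge: "polygon_edge vs i = frame ` closed_segment (zs ! i) (zs ! (Suc i mod n))" if "i < n" for i
    using that by (simp add: polygon_edge_def n_def[symmetric] vs frame_closed_segment mod)
  interpret planar_polygon zs n
  proof (unfold_locales, simp_all add: len n3)
    have "vs = map frame zs"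
      by (rule nth_equalityI) (use vs len in \<open>auto simp: lvs\<close>)
    then show "distinct zs"
      using simple by (simp add: simple_polygon_def distinct_map)
    fix i j assume ij: "i < n" "j < n" "i \<noteq> j"
    then have "polygon_edge vs i \<inter> polygon_edge vs j
        \<subseteq> {vs ! i, vs ! (Suc i mod n)} \<inter> {vs ! j, vs ! (Suc j mod n)}"
      using simple by (simp add: simple_polygon_def lvs)
    then have "frame ` (closed_segment (zs ! i) (zs ! (Suc i mod n)) \<inter> closed_segment (zs ! j) (zs ! (Suc j mod n)))
        \<subseteq> frame ` ({zs ! i, zs ! (Suc i mod n)} \<inter> {zs ! j, zs ! (Suc j mod n)})"
      using ij by (simp add: edge vs mod image_Int[OF inj_frame])
    then show "closed_segment (zs ! i) (zs ! (Suc i mod n)) \<inter> closed_segment (zs ! j) (zs ! (Suc j mod n))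
        \<subseteq> {zs ! i, zs ! (Suc i mod n)} \<and> closed_segment (zs ! i) (zs ! (Suc i mod n)) \<inter> closed_segment (zs ! j) (zs ! (Suc j mod n)) \<subseteq> {zs ! j, zs ! (Suc j mod n)}"
      by (simp add: inj_image_subset_iff[OF inj_frame])
  qed
  have curve: "polygon_curve vs = frame ` curve"
    unfolding polygon_curve_def curve_def nxt_def lvs by (simp add: edge image_UN)
  have S: "S = frame ` region"
  proof -
    have "{x \<in> H - frame ` curve. bounded (connected_component_set (H - frame ` curve) x)} = frame ` inside curve"
      (is "?A = _")
    proof (intro set_eqI iffI)
      fix x assume "x \<in> ?A"
      then obtain z where z: "x = frame z" "z \<notin> curve" using range_frame' by blast
      then show "x \<in> frame ` inside curve"
        using \<open>x \<in> ?A\<close> frame_bounded_component[OF z(2)] by (auto simp: inside_def)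
    next
      fix x assume "x \<in> frame ` inside curve"
      then obtain z where z: "x = frame z" "z \<in> inside curve" by blast
      then show "x \<in> ?A"
        using frame_bounded_component[of z curve] range_frame' by (auto simp: inside_def dest: injD[OF inj_frame])
    qed
    then show ?thesis
      unfolding S_def polygon_region_def curve region_def by (simp add: image_Un)
  qed
  show "compact S"
    unfolding S by (intro compact_continuous_image continuous_frame compact_region)

  define D where "D i = cdet (zs ! i) (nxt i)" for i
  have vec: "frame z - P = k + (frame z - C)" for z by (simp add: k_def)
  have kperp: "k \<bullet> (frame z - C) = 0" for z
    using k by (simp add: frame_def inner_add_right)
  have cross: "(frame z - P) \<times> (frame w - P) = cdet z w *\<^sub>R m + k \<times> (frame w - C) - k \<times> (frame z - C)" for z w
  proof -
    have "(frame z - C) \<times> (frame w - C) = cdet z w *\<^sub>R m"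
      unfolding m_def frame_def cdet_def
      by (simp add: cross_add_left cross_add_right cross_mult_left cross_mult_right
          cross_skew[of e2 e1] algebra_simps)
    moreover have "(frame z - C) \<times> k = - (k \<times> (frame z - C))" by (rule cross_skew)
    ultimately show ?thesis
      unfolding vec by (simp add: cross_add_left cross_add_right)
  qed
  have N: "N = (\<Sum>i<n. D i) *\<^sub>R m"
  proof -
    have "N = (\<Sum>i<n. D i *\<^sub>R m + k \<times> (frame (nxt i) - C) - k \<times> (frame (zs ! i) - C))"
      unfolding N_def doubled_vector_area_def lvs D_def cross[symmetric]
      by (rule sum.cong) (auto simp: vs mod nxt_def)
    also have "\<dots> = (\<Sum>i<n. D i *\<^sub>R m)"
      by (simp add: sum.distrib sum_subtractf sum_nxt[of "\<lambda>z. k \<times> (frame z - C)"])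
    finally show ?thesis by (simp add: scaleR_left.sum)
  qed
  obtain e :: real where e: "e = 1 \<or> e = -1" and area: "measure lborel region = e * (\<Sum>i<n. D i) / 2"
    and disc: "\<And>r. 0 < r \<Longrightarrow> measure lborel (region \<inter> cball 0 r) =
       e * (\<Sum>i<n. edge_term (r\<^sup>2) (D i) (zs ! i) (nxt i)) / 2"
    using region_area_formula unfolding D_def by blast
  define L where "L = e * (\<Sum>i<n. D i)"
  have L: "0 < L" using measure_region_pos area by (simp add: L_def)
  have NeL: "N = (e * L) *\<^sub>R m" using e by (auto simp: N L_def)
  have "norm m = 1" using mm by (simp add: norm_eq_sqrt_inner)
  then have normN: "norm N = L" using e L by (auto simp: NeL)
  with L show "0 < norm N" by simp
  have area': "L / 2 = measure lborel region" using area by (simp add: L_def)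
  have "emeasure lborel region \<noteq> \<infinity>"
    using emeasure_bounded_finite[OF compact_imp_bounded[OF compact_region]] by simp
  then show "emeasure (plane_area H) S = ennreal (norm N / 2)"
    unfolding S normN area'
    by (simp add: measure_frame_image(1)[OF compact_region] emeasure_eq_ennreal_measure)
  have unit: "N \<bullet> x / norm N = e * (m \<bullet> x)" for x
    using L unfolding normN by (simp add: NeL)
  have h: "h\<^sup>2 = k \<bullet> k"
  proof -
    have "m \<bullet> (frame z - P) = \<kappa>" for z
      unfolding vec inner_add_right using k orthonormal
      by (simp add: \<kappa>_def inner_commute frame_def inner_add_right m_def dot_cross_self inner_add_left)
    then have "h = e * \<kappa>"
      unfolding h_def unit using n3 by (simp add: vs)
    then show ?thesis
      using e by (auto simp: km mm power2_eq_square)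
  qed
  have in_disc: "frame z \<in> cball P d \<longleftrightarrow> (norm z)\<^sup>2 \<le> R" for z
  proof -
    have "(norm (frame z - P))\<^sup>2 = k \<bullet> k + (frame z - C) \<bullet> (frame z - C)"
      unfolding vec power2_norm_eq_inner by (simp add: inner_add_left inner_add_right kperp inner_commute)
    then have "(norm (frame z - P))\<^sup>2 = h\<^sup>2 + (norm z)\<^sup>2"
      by (simp add: h inner_frame power2_norm_eq_inner)
    moreover have "frame z \<in> cball P d \<longleftrightarrow> (norm (frame z - P))\<^sup>2 \<le> d\<^sup>2"
      using d by (simp add: dist_norm norm_minus_commute)
    ultimately show ?thesis by (simp add: R_def algebra_simps)
  qed
  show "measure (plane_area H) (S \<inter> cball P d) = (if R \<le> 0 then 0 else
       (\<Sum>i<length vs. let a = vs ! i - P; b = vs ! (Suc i mod length vs) - P in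
          edge_term R (N \<bullet> (a \<times> b) / norm N) a b) / 2)"
  proof (cases "R \<le> 0")
    case True
    have zero: "(norm z)\<^sup>2 \<le> R \<Longrightarrow> z = 0" for z :: complex
      using True by (metis norm_eq_zero order_trans power2_less_eq_zero_iff)
    have "S \<inter> cball P d = frame ` (region \<inter> {z. (norm z)\<^sup>2 \<le> R})"
      unfolding S by (auto simp: in_disc simp del: mem_cball)
    moreover from zero have "region \<inter> {z. (norm z)\<^sup>2 \<le> R} = {} \<or> region \<inter> {z. (norm z)\<^sup>2 \<le> R} = {0}"
      by blast
    ultimately show ?thesis
      using True measure_frame_image(2)[of "{0}"] by auto
  next
    case False
    define r where "r = sqrt R"
    have r: "0 < r" "r\<^sup>2 = R" using False by (simp_all add: r_def)
    have "S \<inter> cball P d = frame ` (region \<inter> cball 0 r)"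
    proof -
      have "norm z \<le> r \<longleftrightarrow> (norm z)\<^sup>2 \<le> R" for z :: complex
        using r by (metis abs_le_square_iff abs_norm_cancel abs_of_pos)
      then show ?thesis unfolding S by (auto simp: in_disc simp del: mem_cball)
    qed
    then have "measure (plane_area H) (S \<inter> cball P d) = measure lborel (region \<inter> cball 0 r)"
      by (simp add: measure_frame_image compact_Int compact_region)
    also have "\<dots> = (\<Sum>i<n. edge_term R (e * D i) (zs ! i) (nxt i)) / 2"
      using disc[OF r(1)] e by (simp add: r edge_term_sign sum_distrib_left)
    also have "(\<Sum>i<n. edge_term R (e * D i) (zs ! i) (nxt i)) =
        (\<Sum>i<length vs. let a = vs ! i - P; b = vs ! (Suc i mod length vs) - P in
          edge_term R (N \<bullet> (a \<times> b) / norm N) a b)"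
    proof (rule sum.cong)
      fix i assume "i \<in> {..<length vs}"
      then have i: "i < n" by (simp add: lvs)
      define z w where "z = zs ! i" and "w = nxt i"
      have ab: "vs ! i - P = frame z - P" "vs ! (Suc i mod length vs) - P = frame w - P"
        using i by (simp_all add: vs mod z_def w_def nxt_def lvs)
      have "m \<bullet> (k \<times> x) = 0" for x
        by (simp add: km cross_mult_left dot_cross_self)
      then have "m \<bullet> ((frame z - P) \<times> (frame w - P)) = D i"
        unfolding cross by (simp add: inner_add_right inner_diff_right mm D_def z_def w_def)
      then have "N \<bullet> ((frame z - P) \<times> (frame w - P)) / norm N = e * D i"
        unfolding unit by simp
      moreover have "(frame x - P) \<bullet> (frame w - frame z) = x \<bullet> (w - z)" for x
      proof -
        have "frame w - frame z = frame (w - z) - C" by (simp add: frame_def algebra_simps)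
        then show ?thesis
          unfolding vec by (simp add: inner_add_left kperp inner_frame)
      qed
      moreover have "(frame w - frame z) \<bullet> (frame w - frame z) = (w - z) \<bullet> (w - z)"
        using dist_frame[of w z] by (simp add: dist_norm dot_square_norm)
      ultimately show "edge_term R (e * D i) (zs ! i) (nxt i) =
        (let a = vs ! i - P; b = vs ! (Suc i mod length vs) - P in
          edge_term R (N \<bullet> (a \<times> b) / norm N) a b)"
        unfolding ab Let_def by (simp add: edge_term_def z_def w_def)
    qed (simp add: lvs)
    finally show ?thesis using False by simp
  qed
qed

section \<open>Execution of loop-free commands and of counting loops\<close>

text \<open>
  A functional semantics of loop-free commands, so that their effect can be computed by rewriting. The
  values at loops are defaults: a command that contains a loop is never \<open>safe\<close>.
\<close>

primrec run :: "com \<Rightarrow> state \<Rightarrow> state" where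
  "run Skip s = s"
| "run (NStore a e) s = s\<lparr>nat_mem := (nat_mem s)(nval a s := nval e s)\<rparr>"
| "run (RStore a e) s = s\<lparr>real_mem := (real_mem s)(nval a s := rval e s)\<rparr>"
| "run (Seq c1 c2) s = run c2 (run c1 s)"
| "run (Cond b c1 c2) s = (if bval b s then run c1 s else run c2 s)"
| "run (While b c) s = s"

primrec safe :: "com \<Rightarrow> state \<Rightarrow> bool" where
  "safe Skip s \<longleftrightarrow> True"
| "safe (NStore a e) s \<longleftrightarrow> True"
| "safe (RStore a e) s \<longleftrightarrow> rdefined e s"
| "safe (Seq c1 c2) s \<longleftrightarrow> safe c1 s \<and> safe c2 (run c1 s)"
| "safe (Cond b c1 c2) s \<longleftrightarrow> bdefined b s \<and> (if bval b s then safe c1 s else safe c2 s)"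
| "safe (While b c) s \<longleftrightarrow> False"

primrec worst_time :: "com \<Rightarrow> nat" where
  "worst_time Skip = 1"
| "worst_time (NStore a e) = 1 + ncost a + ncost e"
| "worst_time (RStore a e) = 1 + ncost a + rcost e"
| "worst_time (Seq c1 c2) = 1 + worst_time c1 + worst_time c2"
| "worst_time (Cond b c1 c2) = 1 + bcost b + worst_time c1 + worst_time c2"
| "worst_time (While b c) = 0"

lemma exec_run: "safe c s \<Longrightarrow> \<exists>t \<le> worst_time c. exec c s t (run c s)"
proof (induction c arbitrary: s)
  case (Seq c1 c2)
  from Seq.IH(1)[of s] Seq.prems obtain t1 where 1: "t1 \<le> worst_time c1" "exec c1 s t1 (run c1 s)"
    by auto
  from Seq.IH(2)[of "run c1 s"] Seq.prems obtain t2 where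
    2: "t2 \<le> worst_time c2" "exec c2 (run c1 s) t2 (run c2 (run c1 s))"
    by auto
  show ?case
    using exec.Seq[OF 1(2) 2(2)] 1(1) 2(1) by (intro exI[of _ "1 + t1 + t2"]) simp
next
  case (Cond b c1 c2)
  show ?case
  proof (cases "bval b s")
    case True
    then obtain t where t: "t \<le> worst_time c1" "exec c1 s t (run c1 s)"
      using Cond.IH(1)[of s] Cond.prems by auto
    then show ?thesis
      using exec.CondTrue[OF _ True t(2)] Cond.prems True
      by (intro exI[of _ "1 + bcost b + t"]) auto
  next
    case False
    then obtain t where t: "t \<le> worst_time c2" "exec c2 s t (run c2 s)"
      using Cond.IH(2)[of s] Cond.prems by auto
    then show ?thesis
      using exec.CondFalse[OF _ False t(2)] Cond.prems False
      by (intro exI[of _ "1 + bcost b + t"]) auto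
  qed
next
  case (NStore a e)
  show ?case using exec.NStore[of a e s] by auto
next
  case (RStore a e)
  then show ?case using exec.RStore[of e s a] by auto
next
  case Skip
  show ?case using exec.Skip[of s] by auto
qed simp

text \<open>
  A loop with a loop-free body that runs exactly \<open>m\<close> times; the invariant \<open>I\<close> carries the number of
  completed iterations.
\<close>

lemma exec_While_count:
  assumes step: "\<And>k s. k < m \<Longrightarrow> I k s \<Longrightarrow> bdefined b s \<and> bval b s \<and> safe c s \<and> I (Suc k) (run c s)"
    and stop: "\<And>s. I m s \<Longrightarrow> bdefined b s \<and> \<not> bval b s"
    and start: "I 0 s"
  obtains t s' where "exec (While b c) s t s'" "I m s'" "t \<le> (m + 1) * (1 + bcost b + worst_time c)"
proof -
  let ?K = "1 + bcost b + worst_time c"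
  have "\<exists>t s'. exec (While b c) s t s' \<and> I m s' \<and> t \<le> (j + 1) * ?K"
    if "I (m - j) s" "j \<le> m" for j s
    using that
  proof (induction j arbitrary: s)
    case 0
    then have "exec (While b c) s (1 + bcost b) s"
      using stop[of s] by (intro exec.WhileFalse) auto
    with 0 show ?case by fastforce
  next
    case (Suc j)
    then have s: "bdefined b s" "bval b s" "safe c s" "I (m - j) (run c s)"
      using step[of "m - Suc j" s] by (auto simp: Suc_diff_Suc)
    from exec_run[OF s(3)] obtain t1 where t1: "t1 \<le> worst_time c" "exec c s t1 (run c s)" by blast
    from Suc.IH[OF s(4)] Suc.prems obtain t2 s' where
      t2: "exec (While b c) (run c s) t2 s'" "I m s'" "t2 \<le> (j + 1) * ?K" by auto
    have "exec (While b c) s (1 + bcost b + t1 + t2) s'"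
      by (rule exec.WhileTrue[OF s(1,2) t1(2) t2(1)])
    moreover have "1 + bcost b + t1 + t2 \<le> (Suc j + 1) * ?K"
      using t1(1) t2(3) by simp
    ultimately show ?case using t2(2) by blast
  qed
  from this[of m s] start show thesis using that by auto
qed

section \<open>Derived expressions\<close>

text \<open>
  Maxima come from \<open>max x y = (x + y + |x - y|) / 2\<close> with the absolute value as the root of a square,
  which saves branching.
\<close>

definition rmax :: "rexp \<Rightarrow> rexp \<Rightarrow> rexp" where
  "rmax x y = RDiv (RAdd (RAdd x y) (RSqrt (RMul (RSub x y) (RSub x y)))) (RConst 2)"

definition rmin :: "rexp \<Rightarrow> rexp \<Rightarrow> rexp" where
  "rmin x y = RSub (RAdd x y) (rmax x y)"

text \<open>
  The arccotangent \<open>\<pi> / 2 - arctan x\<close>. In the differences of arctangents that are needed, the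
  \<open>\<pi> / 2\<close> drops out.
\<close>

definition rarccot :: "rexp \<Rightarrow> rexp" where
  "rarccot x = RArccos (RDiv x (RSqrt (RAdd (RConst 1) (RMul x x))))"

lemma rmax_simps [simp]:
  "rval (rmax x y) s = max (rval x s) (rval y s)"
  "rdefined (rmax x y) s \<longleftrightarrow> rdefined x s \<and> rdefined y s"
  by (auto simp: rmax_def max_def)

lemma rmin_simps [simp]:
  "rval (rmin x y) s = min (rval x s) (rval y s)"
  "rdefined (rmin x y) s \<longleftrightarrow> rdefined x s \<and> rdefined y s"
  by (auto simp: rmin_def max_def min_def)

lemma arccos_eq_arctan: "arccos (x / sqrt (1 + x\<^sup>2)) = pi / 2 - arctan x"
proof -
  have "arccos (cos (pi / 2 - arctan x)) = pi / 2 - arctan x"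
    using arctan_bounded[of x] by (intro arccos_cos) auto
  then show ?thesis by (simp add: cos_diff sin_arctan)
qed

lemma abs_div_sqrt_le: "\<bar>x / sqrt (1 + x\<^sup>2)\<bar> \<le> (1 :: real)"
  using abs_sin_le_one[of "arctan x"] by (simp only: sin_arctan)

lemma rarccot_simps [simp]:
  "rval (rarccot x) s = pi / 2 - arctan (rval x s)"
  "rdefined (rarccot x) s \<longleftrightarrow> rdefined x s"
proof -
  have "0 < 1 + (rval x s)\<^sup>2" by (simp add: add_pos_nonneg)
  moreover have "- 1 \<le> rval x s / sqrt (1 + (rval x s)\<^sup>2)" "rval x s / sqrt (1 + (rval x s)\<^sup>2) \<le> 1"
    using abs_div_sqrt_le[of "rval x s"] by linarith+
  ultimately show "rval (rarccot x) s = pi / 2 - arctan (rval x s)" "rdefined (rarccot x) s \<longleftrightarrow> rdefined x s"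
    using arccos_eq_arctan[of "rval x s"] by (auto simp: rarccot_def power2_eq_square)
qed

text \<open>
  Vectors in space as triples of expressions, indexed from \<open>0\<close>.
\<close>

type_synonym vexp = "nat \<Rightarrow> rexp"

definition vval :: "vexp \<Rightarrow> state \<Rightarrow> point" where
  "vval x s = vector [rval (x 0) s, rval (x 1) s, rval (x 2) s]"

definition vdefined :: "vexp \<Rightarrow> state \<Rightarrow> bool" where
  "vdefined x s \<longleftrightarrow> (\<forall>k\<in>{0, 1, 2}. rdefined (x k) s)"

definition vsub :: "vexp \<Rightarrow> vexp \<Rightarrow> vexp" where
  "vsub x y k = RSub (x k) (y k)"

definition vdot :: "vexp \<Rightarrow> vexp \<Rightarrow> rexp" where
  "vdot x y = RAdd (RAdd (RMul (x 0) (y 0)) (RMul (x 1) (y 1))) (RMul (x 2) (y 2))"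

definition vcross :: "vexp \<Rightarrow> vexp \<Rightarrow> vexp" where
  "vcross x y k = (let i = (k + 1) mod 3; j = (k + 2) mod 3 in
     RSub (RMul (x i) (y j)) (RMul (x j) (y i)))"

lemma vval_nth: "rval (x 0) s = vval x s $ 1" "rval (x (Suc 0)) s = vval x s $ 2" "rval (x 2) s = vval x s $ 3"
  by (simp_all add: vval_def)

lemma vec3_eqI: "x $ 1 = y $ 1 \<Longrightarrow> x $ 2 = y $ 2 \<Longrightarrow> x $ 3 = y $ 3 \<Longrightarrow> x = (y :: point)"
  by (simp add: vec_eq_iff forall_3)

lemma vsub_simps [simp]:
  "vval (vsub x y) s = vval x s - vval y s"
  "vdefined (vsub x y) s \<longleftrightarrow> vdefined x s \<and> vdefined y s"
  by (auto simp: vsub_def vdefined_def vval_def intro!: vec3_eqI)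

lemma vdot_simps [simp]:
  "rval (vdot x y) s = vval x s \<bullet> vval y s"
  "rdefined (vdot x y) s \<longleftrightarrow> vdefined x s \<and> vdefined y s"
  by (auto simp: vdot_def vdefined_def vval_def inner_vec_def sum_3)

lemma vcross_simps [simp]:
  "vval (vcross x y) s = vval x s \<times> vval y s"
  "vdefined (vcross x y) s \<longleftrightarrow> vdefined x s \<and> vdefined y s"
  by (auto simp: vcross_def Let_def vdefined_def vval_def cross3_def numeral_2_eq_2 intro!: vec3_eqI)

lemma vdefined_nth:
  assumes "vdefined x s"
  shows "rdefined (x 0) s" "rdefined (x (Suc 0)) s" "rdefined (x 2) s"
  using assms by (auto simp: vdefined_def)

section \<open>The program\<close>

text \<open>
  Natural cell \<open>1\<close> holds the address just after the vertices, cell \<open>2\<close> the address of the current vertex. The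
  first vertex is copied to the end, so that every edge joins two consecutive entries of the array
  without a wrap-around; the scratch cells start after this copy. There, cells \<open>0\<close> to \<open>2\<close> accumulate \<open>N\<close>,
  cell \<open>3\<close> is the length of \<open>N\<close>, cell \<open>4\<close> the squared radius of the disc, cell \<open>5\<close> accumulates the edge terms,
  and cells \<open>6\<close> to \<open>8\<close> are \<open>D\<close>, \<open>g\<close> and \<open>w\<close> for the current edge.
\<close>

definition end_ptr :: nexp where "end_ptr = NLoad (NConst 1)"
definition vertex_ptr :: nexp where "vertex_ptr = NLoad (NConst 2)"

definition scratch :: "nat \<Rightarrow> nexp" where "scratch j = NAdd end_ptr (NConst (3 + j))"

definition vec_at :: "nexp \<Rightarrow> vexp" where
  "vec_at p k = RLoad (NAdd p (NConst k))"

definition rel_from :: vexp where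
  "rel_from = vsub (vec_at vertex_ptr) (vec_at (NConst 0))"

definition rel_to :: vexp where
  "rel_to = vsub (vec_at (NAdd vertex_ptr (NConst 3))) (vec_at (NConst 0))"

definition normal :: vexp where "normal = vec_at (scratch 0)"
definition normal_length :: rexp where "normal_length = RLoad (scratch 3)"
definition radius_sq :: rexp where "radius_sq = RLoad (scratch 4)"
definition area_sum :: rexp where "area_sum = RLoad (scratch 5)"
definition edge_det :: rexp where "edge_det = RLoad (scratch 6)"
definition edge_len_sq :: rexp where "edge_len_sq = RLoad (scratch 7)"
definition clamp_bound :: rexp where "clamp_bound = RLoad (scratch 8)"

definition advance :: com where
  "advance = NStore (NConst 2) (NAdd vertex_ptr (NConst 3))"

definition setup_program :: com where
  "setup_program =
    Seq (NStore (NConst 1) (NAdd (NConst 4) (NAdd (NLoad (NConst 0)) (NAdd (NLoad (NConst 0)) (NLoad (NConst 0))))))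
   (Seq (RStore end_ptr (RLoad (NConst 4)))
   (Seq (RStore (NAdd end_ptr (NConst 1)) (RLoad (NConst 5)))
   (Seq (RStore (NAdd end_ptr (NConst 2)) (RLoad (NConst 6)))
        (NStore (NConst 2) (NConst 4)))))"

definition add_cross :: com where
  "add_cross =
    Seq (RStore (scratch 0) (RAdd (RLoad (scratch 0)) (vcross rel_from rel_to 0)))
   (Seq (RStore (scratch 1) (RAdd (RLoad (scratch 1)) (vcross rel_from rel_to 1)))
   (Seq (RStore (scratch 2) (RAdd (RLoad (scratch 2)) (vcross rel_from rel_to 2)))
        advance))"

text \<open>
  Scratch cell \<open>4\<close> first receives the distance of \<open>P\<close> from the plane, up to sign, which the last command
  reads through \<open>radius_sq\<close>.
\<close>

definition disc_setup :: com where
  "disc_setup =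
    Seq (NStore (NConst 2) (NConst 4))
   (Seq (RStore (scratch 3) (RSqrt (vdot normal normal)))
   (Seq (RStore (scratch 4) (RDiv (vdot normal rel_from) normal_length))
        (RStore (scratch 4) (RSub (RMul (RLoad (NConst 3)) (RLoad (NConst 3))) (RMul radius_sq radius_sq)))))"

definition clamp_expr :: "rexp \<Rightarrow> rexp" where
  "clamp_expr u =
    (let c = rmax (RSub (RConst 0) clamp_bound) (rmin clamp_bound u) in
     RAdd (RDiv (RMul edge_det c) edge_len_sq)
       (RMul radius_sq (RSub (rarccot (RDiv c edge_det)) (rarccot (RDiv u edge_det)))))"

definition add_edge_term :: com where
  "add_edge_term =
    Seq (RStore (scratch 6) (RDiv (vdot normal (vcross rel_from rel_to)) normal_length))
   (Seq (Cond (BAnd (BNot (RLess edge_det (RConst 0))) (BNot (RLess (RConst 0) edge_det)))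
          Skip
         (Seq (RStore (scratch 7) (vdot (vsub rel_to rel_from) (vsub rel_to rel_from)))
         (Seq (RStore (scratch 8) (RSqrt (rmax (RConst 0)
                 (RSub (RMul edge_len_sq radius_sq) (RMul edge_det edge_det)))))
              (RStore (scratch 5) (RAdd area_sum
                (RSub (clamp_expr (vdot rel_to (vsub rel_to rel_from)))
                      (clamp_expr (vdot rel_from (vsub rel_to rel_from)))))))))
        advance)"

definition each_edge :: "com \<Rightarrow> com" where
  "each_edge c = While (NLess vertex_ptr end_ptr) c"

text \<open>
  The accumulated edge terms and the length of \<open>N\<close> are both twice an area, so their quotient is the
  probability. A squared radius that is
  not positive means that the ball meets the plane in at most one point.
\<close>

definition cdf_program :: com where
  "cdf_program =
    Seq setup_program
   (Seq (each_edge add_cross)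
   (Seq disc_setup
        (Cond (RLess (RConst 0) radius_sq)
          (Seq (each_edge add_edge_term)
               (RStore (NConst 0) (RDiv area_sum normal_length)))
          (RStore (NConst 0) (RConst 0)))))"

section \<open>Correctness and running time of the program\<close>

lemma length_coords [simp]: "length (coords x) = 3"
  by (simp add: coords_def)

lemma coords_nth [simp]: "coords x ! 0 = x $ 1" "coords x ! Suc 0 = x $ 2" "coords x ! 2 = x $ 3"
  by (simp_all add: coords_def)

lemma length_concat_coords: "length (concat (map coords vs)) = 3 * length vs"
  by (induction vs) simp_all

lemma concat_coords_nth:
  "i < length vs \<Longrightarrow> j < 3 \<Longrightarrow> concat (map coords vs) ! (3 * i + j) = coords (vs ! i) ! j"
proof (induction vs arbitrary: i)
  case (Cons v vs)
  then show ?case by (cases i) (simp_all add: nth_append)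
qed simp

lemma real_mem_input:
  "real_mem (input vs P d) 0 = P $ 1" "real_mem (input vs P d) (Suc 0) = P $ 2"
  "real_mem (input vs P d) 2 = P $ 3" "real_mem (input vs P d) 3 = d"
  "i < length vs \<Longrightarrow> j < 3 \<Longrightarrow> real_mem (input vs P d) (4 + 3 * i + j) = coords (vs ! i) ! j"
  "4 + 3 * length vs \<le> a \<Longrightarrow> real_mem (input vs P d) a = 0"
  using concat_coords_nth[of i vs j]
  by (auto simp: input_def Let_def nth_append length_concat_coords)

text \<open>
  Addresses are compared as sums of a numeral and a variable, a form that these rules destroy.
\<close>

declare add_2_eq_Suc [simp del] add_2_eq_Suc' [simp del]

locale polygon_input =
  fixes vs :: "point list" and P :: point and d :: real and n e :: nat
  assumes n: "n = length vs" "1 \<le> n" and e: "e = 4 + 3 * n"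
begin

text \<open>
  The real memory after the setup: the memory of an input whose vertex list is closed by repeating its
  first element.
\<close>

definition closed_mem :: "nat \<Rightarrow> real" where
  "closed_mem = real_mem (input (vs @ [hd vs]) P d)"

definition from_vec :: "nat \<Rightarrow> point" where "from_vec i = vs ! i - P"
definition to_vec :: "nat \<Rightarrow> point" where "to_vec i = vs ! (Suc i mod n) - P"

definition loaded :: "(nat \<Rightarrow> nat) \<Rightarrow> (nat \<Rightarrow> real) \<Rightarrow> bool" where
  "loaded f m \<longleftrightarrow> f 1 = e \<and> (\<forall>a<e + 3. m a = closed_mem a)"

lemma loaded_upd [simp]:
  "loaded (f(2 := v)) m \<longleftrightarrow> loaded f m"
  "3 + e \<le> a \<Longrightarrow> loaded f (m(a := x)) \<longleftrightarrow> loaded f m"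
  by (auto simp: loaded_def)

lemma nval_scratch [simp]:
  "loaded (nat_mem s) (real_mem s) \<Longrightarrow> nval (scratch j) s = (3 + j) + e"
  by (simp add: scratch_def end_ptr_def loaded_def)

lemma closed_mem_low:
  "closed_mem 0 = P $ 1" "closed_mem (Suc 0) = P $ 2" "closed_mem 2 = P $ 3" "closed_mem 3 = d"
  unfolding closed_mem_def by (rule real_mem_input)+

lemma closed_mem_vertex:
  assumes "i \<le> n" "j < 3"
  shows "closed_mem (4 + 3 * i + j) = coords (vs ! (i mod n)) ! j"
proof -
  have "(vs @ [hd vs]) ! i = vs ! (i mod n)"
  proof (cases "i = n")
    case True
    have "vs \<noteq> []" using n by auto
    then show ?thesis using True n by (simp add: nth_append hd_conv_nth)
  next
    case False
    then show ?thesis using assms n by (simp add: nth_append)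
  qed
  then show ?thesis
    unfolding closed_mem_def using real_mem_input(5)[of i "vs @ [hd vs]" j P d] assms n by simp
qed

lemma closed_mem_high: "e + 3 \<le> a \<Longrightarrow> closed_mem a = 0"
  unfolding closed_mem_def using n e by (intro real_mem_input(6)) simp

lemma run_setup:
  "safe setup_program (input vs P d)"
  "nat_mem (run setup_program (input vs P d)) 1 = e"
  "nat_mem (run setup_program (input vs P d)) 2 = 4"
  "real_mem (run setup_program (input vs P d)) = closed_mem"
proof -
  have nat0: "nat_mem (input vs P d) 0 = n" by (simp add: input_def Let_def n)
  show "safe setup_program (input vs P d)"
    by (simp add: setup_program_def)
  show "nat_mem (run setup_program (input vs P d)) 1 = e"
    "nat_mem (run setup_program (input vs P d)) 2 = 4"
    by (simp_all add: setup_program_def nat0 e)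
  let ?m = "real_mem (input vs P d)"
  have "real_mem (run setup_program (input vs P d)) = ?m(e := ?m 4, e + 1 := ?m 5, e + 2 := ?m 6)"
    using e n by (simp add: setup_program_def nat0 end_ptr_def eval_nat_numeral)
  also have "\<dots> = closed_mem"
  proof
    fix a
    have closed: "closed_mem (e + j) = coords (vs ! 0) ! j" if "j < 3" for j
      using closed_mem_vertex[of n j] that by (simp add: e)
    have m: "?m (4 + j) = coords (vs ! 0) ! j" if "j < 3" for j
    proof -
      have "vs \<noteq> []" using n by auto
      then show ?thesis using real_mem_input(5)[of 0 vs j P d] that by simp
    qed
    have hd: "?m 4 = closed_mem e" "?m 5 = closed_mem (e + 1)" "?m 6 = closed_mem (e + 2)"
      using closed[of 0] closed[of 1] closed[of 2] m[of 0] m[of 1] m[of 2] by simp_all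
    consider "a < e" | "a = e" | "a = e + 1" | "a = e + 2" | "e + 3 \<le> a" by linarith
    then show "(?m(e := ?m 4, e + 1 := ?m 5, e + 2 := ?m 6)) a = closed_mem a"
    proof cases
      case 1
      define xs where "xs = coords P @ [d] @ concat (map coords vs)"
      have "length xs = e" by (simp add: xs_def length_concat_coords e n)
      have "closed_mem a = (xs @ coords (hd vs)) ! a"
        using 1 by (simp add: closed_mem_def input_def Let_def xs_def length_concat_coords e n)
      also have "\<dots> = xs ! a" using 1 \<open>length xs = e\<close> by (simp add: nth_append)
      also have "\<dots> = ?m a"
        using 1 \<open>length xs = e\<close> by (simp add: input_def Let_def xs_def)
      finally have "?m a = closed_mem a" ..
      with 1 show ?thesis by simp
    next
      case 5
      then have "?m a = 0" using e n by (intro real_mem_input(6)) simp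
      with 5 show ?thesis by (simp add: closed_mem_high)
    qed (simp_all add: hd)
  qed
  finally show "real_mem (run setup_program (input vs P d)) = closed_mem" .
qed

lemma vdefined_vec_at [simp]: "vdefined (vec_at p) s"
  by (simp add: vdefined_def vec_at_def)

lemma vdefined_rel [simp]: "vdefined rel_from s" "vdefined rel_to s" "vdefined normal s"
  by (simp_all add: rel_from_def rel_to_def normal_def)

lemma vval_rel:
  assumes "loaded (nat_mem s) (real_mem s)" "nat_mem s 2 = 4 + 3 * i" "i < n"
  shows "vval rel_from s = from_vec i" "vval rel_to s = to_vec i"
proof -
  have low: "real_mem s a = closed_mem a" if "a < e + 3" for a
    using assms(1) that by (simp add: loaded_def)
  have P: "vval (vec_at (NConst 0)) s = P"
    by (rule vec3_eqI) (simp_all add: vval_def vec_at_def low closed_mem_low)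
  have vertex: "vval (vec_at p) s = vs ! (k mod n)" if "nval p s = 4 + 3 * k" "k \<le> n" for p k
  proof -
    have "real_mem s (4 + 3 * k + j) = coords (vs ! (k mod n)) ! j" if "j < 3" for j
      using closed_mem_vertex[of k j] low[of "4 + 3 * k + j"] that \<open>k \<le> n\<close> e by simp
    from this[of 0] this[of 1] this[of 2] show ?thesis
      by (intro vec3_eqI) (simp_all add: vval_def vec_at_def that(1))
  qed
  show "vval rel_from s = from_vec i"
    using vertex[of vertex_ptr i] assms
    by (simp add: rel_from_def P from_vec_def vertex_ptr_def)
  show "vval rel_to s = to_vec i"
    using vertex[of "NAdd vertex_ptr (NConst 3)" "Suc i"] assms
    by (simp add: rel_to_def P to_vec_def vertex_ptr_def)
qed

definition partial_normal :: "nat \<Rightarrow> point" where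
  "partial_normal k = (\<Sum>i<k. from_vec i \<times> to_vec i)"

definition normal_inv :: "nat \<Rightarrow> state \<Rightarrow> bool" where
  "normal_inv k s \<longleftrightarrow> loaded (nat_mem s) (real_mem s) \<and> nat_mem s 2 = 4 + 3 * k \<and>
     vval normal s = partial_normal k \<and> real_mem s (8 + e) = 0"

lemma vval_normal:
  "loaded (nat_mem s) (real_mem s) \<Longrightarrow>
    vval normal s = vector [real_mem s (3 + e), real_mem s (4 + e), real_mem s (5 + e)]"
  by (simp add: normal_def vval_def vec_at_def)

lemma normal_step:
  assumes "k < n" "normal_inv k s"
  shows "safe add_cross s \<and> normal_inv (Suc k) (run add_cross s)"
proof -
  note rel = vval_rel[where i = k, OF _ _ assms(1)]
  have inv: "loaded (nat_mem s) (real_mem s)" "nat_mem s 2 = 4 + 3 * k" "real_mem s (8 + e) = 0"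
    "vval normal s = partial_normal k"
    using assms(2) by (simp_all add: normal_inv_def)
  have N: "real_mem s (3 + e) = partial_normal k $ 1" "real_mem s (4 + e) = partial_normal k $ 2"
    "real_mem s (5 + e) = partial_normal k $ 3"
    unfolding inv(4)[symmetric] by (simp_all add: vval_normal inv(1))
  show ?thesis
    unfolding normal_inv_def
    by (simp add: add_cross_def advance_def vertex_ptr_def vval_nth vdefined_nth inv(1-3) rel vval_normal)
      (simp add: partial_normal_def N vec_eq_iff forall_3)
qed

end

context polygon_input
begin

lemma rval_clamp_expr:
  assumes "rval edge_det s = D" "rval edge_len_sq s = g" "rval radius_sq s = R"
    "rval clamp_bound s = sqrt (max 0 (g * R - D\<^sup>2))"
  shows "rval (clamp_expr u) s = clamp_term R D g (rval u s)"
  unfolding clamp_expr_def clamp_term_def Let_def by (simp add: assms)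

lemma rdefined_clamp_expr:
  assumes "rval edge_det s \<noteq> 0" "rval edge_len_sq s \<noteq> 0" "rdefined u s"
  shows "rdefined (clamp_expr u) s"
proof -
  have "rdefined edge_det s" "rdefined edge_len_sq s" "rdefined radius_sq s" "rdefined clamp_bound s"
    by (simp_all add: edge_det_def edge_len_sq_def radius_sq_def clamp_bound_def)
  then show ?thesis
    unfolding clamp_expr_def Let_def using assms by simp
qed

definition N :: point where "N = partial_normal n"
definition R :: real where "R = d\<^sup>2 - (N \<bullet> from_vec 0 / norm N)\<^sup>2"
definition det_at :: "nat \<Rightarrow> real" where "det_at i = N \<bullet> (from_vec i \<times> to_vec i) / norm N"
definition partial_area :: "nat \<Rightarrow> real" where
  "partial_area k = (\<Sum>i<k. edge_term R (det_at i) (from_vec i) (to_vec i))"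

definition area_inv :: "nat \<Rightarrow> state \<Rightarrow> bool" where
  "area_inv k s \<longleftrightarrow> loaded (nat_mem s) (real_mem s) \<and> nat_mem s 2 = 4 + 3 * k \<and>
     vval normal s = N \<and> real_mem s (6 + e) = norm N \<and> real_mem s (7 + e) = R \<and>
     real_mem s (8 + e) = partial_area k"

lemma disc_setup_step:
  assumes "normal_inv n s" and N: "N \<noteq> 0"
  shows "safe disc_setup s \<and> area_inv 0 (run disc_setup s)"
proof -
  have inv: "loaded (nat_mem s) (real_mem s)" "real_mem s (8 + e) = 0" "vval normal s = N"
    using assms(1) by (simp_all add: normal_inv_def N_def)
  have NN: "vector [real_mem s (3 + e), real_mem s (4 + e), real_mem s (5 + e)] = N"
    unfolding inv(3)[symmetric] by (simp add: vval_normal inv(1))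
  have "0 < n" using n(2) by simp
  note rel = vval_rel(1)[where i = 0, OF _ _ this]
  have low: "real_mem s 3 = d"
  proof -
    have "3 < e + 3" by (simp add: e)
    then show ?thesis using inv(1) by (simp add: loaded_def closed_mem_low)
  qed
  show ?thesis
    unfolding area_inv_def
    by (simp add: disc_setup_def normal_length_def radius_sq_def inv(1,2) rel vval_normal NN N low
        norm_eq_sqrt_inner[symmetric])
      (simp add: partial_area_def R_def power2_eq_square)
qed

text \<open>
  The intermediate states are named, as they are needed to see that no division by zero occurs: \<open>g\<close> is
  positive because the ends of the edge are distinct, \<open>D\<close> is nonzero by the branch, and \<open>N\<close> by assumption.
\<close>

lemma area_step:
  assumes k: "k < n" and inv: "area_inv k s" and N: "N \<noteq> 0" and distinct: "from_vec k \<noteq> to_vec k"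
  shows "safe add_edge_term s \<and> area_inv (Suc k) (run add_edge_term s)"
proof -
  note rel = vval_rel[where i = k, OF _ _ k]
  have s: "loaded (nat_mem s) (real_mem s)" "nat_mem s 2 = 4 + 3 * k" "real_mem s (6 + e) = norm N"
    "real_mem s (7 + e) = R" "real_mem s (8 + e) = partial_area k" "vval normal s = N"
    using inv by (simp_all add: area_inv_def)
  have NN: "vector [real_mem s (3 + e), real_mem s (4 + e), real_mem s (5 + e)] = N"
    unfolding s(6)[symmetric] by (simp add: vval_normal s(1))
  define a b where "a = from_vec k" and "b = to_vec k"
  define D where "D = det_at k"
  define g where "g = (b - a) \<bullet> (b - a)"
  define w where "w = sqrt (max 0 (g * R - D\<^sup>2))"
  have D: "N \<bullet> (from_vec k \<times> to_vec k) / norm N = D" by (simp add: D_def det_at_def)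
  have g: "g \<noteq> 0" using distinct by (simp add: g_def a_def b_def)
  define s1 where "s1 = s\<lparr>real_mem := (real_mem s)(9 + e := D)\<rparr>"
  have s1: "run (RStore (scratch 6) (RDiv (vdot normal (vcross rel_from rel_to)) normal_length)) s = s1"
    "safe (RStore (scratch 6) (RDiv (vdot normal (vcross rel_from rel_to)) normal_length)) s"
    using N by (simp_all add: s1_def s rel normal_length_def D)
  have s1_rval: "rval edge_det s1 = D" "rdefined edge_det s1"
    by (simp_all add: edge_det_def s1_def s(1))
  show ?thesis
  proof (cases "D = 0")
    case True
    have "edge_term R (det_at k) (from_vec k) (to_vec k) = 0"
      using True by (simp add: edge_term_def D_def)
    then show ?thesis
      unfolding add_edge_term_def safe.simps run.simps(4) s1(1)
      using s1(2) by (simp add: s1_rval True)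
        (simp add: area_inv_def s1_def advance_def vertex_ptr_def s(1-5) vval_normal NN partial_area_def)
  next
    case False
    define s2 where "s2 = s\<lparr>real_mem := (real_mem s)(9 + e := D, 10 + e := g)\<rparr>"
    have s2: "run (RStore (scratch 7) (vdot (vsub rel_to rel_from) (vsub rel_to rel_from))) s1 = s2"
      by (simp add: s1_def s2_def s(1,2) rel g_def a_def b_def)
    have s2_rval: "rval edge_det s2 = D" "rval edge_len_sq s2 = g" "rval radius_sq s2 = R"
      "rdefined edge_det s2" "rdefined edge_len_sq s2" "rdefined radius_sq s2"
      by (simp_all add: edge_det_def edge_len_sq_def radius_sq_def s2_def s(1,4))
    define s3 where "s3 = s\<lparr>real_mem := (real_mem s)(9 + e := D, 10 + e := g, 11 + e := w)\<rparr>"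
    let ?c3 = "RStore (scratch 8) (RSqrt (rmax (RConst 0) (RSub (RMul edge_len_sq radius_sq) (RMul edge_det edge_det))))"
    have s3: "run ?c3 s2 = s3" "safe ?c3 s2"
      by (simp_all add: s2_rval) (simp add: s2_def s3_def s(1) w_def power2_eq_square)
    have s3_rval: "rval edge_det s3 = D" "rval edge_len_sq s3 = g" "rval radius_sq s3 = R"
      "rval clamp_bound s3 = w" "rval area_sum s3 = partial_area k" "rdefined area_sum s3"
      "vval rel_from s3 = a" "vval rel_to s3 = b" "nval (scratch 5) s3 = 8 + e"
      by (simp_all add: edge_det_def edge_len_sq_def radius_sq_def clamp_bound_def area_sum_def s3_def s rel a_def b_def)
    let ?c4 = "RStore (scratch 5) (RAdd area_sum (RSub (clamp_expr (vdot rel_to (vsub rel_to rel_from)))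
                      (clamp_expr (vdot rel_from (vsub rel_to rel_from)))))"
    have val: "rval (clamp_expr u) s3 = clamp_term R D g (rval u s3)" for u
      by (rule rval_clamp_expr) (simp_all add: s3_rval w_def)
    have def: "rdefined (clamp_expr u) s3" if "rdefined u s3" for u
      using that False g by (intro rdefined_clamp_expr) (simp_all add: s3_rval)
    have "edge_term R (det_at k) (from_vec k) (to_vec k) =
        clamp_term R D g (b \<bullet> (b - a)) - clamp_term R D g (a \<bullet> (b - a))"
      using False by (simp add: edge_term_def D_def g_def a_def b_def)
    then have s4: "run ?c4 s3 = s\<lparr>real_mem := (real_mem s)(9 + e := D, 10 + e := g, 11 + e := w,
        8 + e := partial_area (Suc k))\<rparr>" "safe ?c4 s3"
      by (simp_all add: val def s3_rval) (simp add: s3_def partial_area_def)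
    have test: "\<not> bval (BAnd (BNot (RLess edge_det (RConst 0))) (BNot (RLess (RConst 0) edge_det))) s1"
      using False by (auto simp: s1_rval)
    have bdef: "bdefined (BAnd (BNot (RLess edge_det (RConst 0))) (BNot (RLess (RConst 0) edge_det))) s1"
      by (simp add: s1_rval)
    have safe2: "safe (RStore (scratch 7) (vdot (vsub rel_to rel_from) (vsub rel_to rel_from))) s1"
      by simp
    have "run add_edge_term s = run advance (s\<lparr>real_mem := (real_mem s)(9 + e := D, 10 + e := g, 11 + e := w,
        8 + e := partial_area (Suc k))\<rparr>)"
      unfolding add_edge_term_def run.simps(4,5) s1(1) if_not_P[OF test] s2 s3(1) s4(1) ..
    moreover have "safe add_edge_term s"
      unfolding add_edge_term_def safe.simps(4,5) run.simps(4,5) s1(1) if_not_P[OF test] s2 s3(1) s4(1)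
      using s1(2) bdef safe2 s3(2) s4(2) by (simp add: advance_def)
    ultimately show ?thesis
      by (simp add: area_inv_def advance_def vertex_ptr_def s(1-4) vval_normal NN)
  qed
qed

lemma each_edge_exec:
  assumes step: "\<And>k s. k < n \<Longrightarrow> I k s \<Longrightarrow> safe c s \<and> I (Suc k) (run c s)"
    and ptr: "\<And>k s. I k s \<Longrightarrow> nat_mem s 1 = e \<and> nat_mem s 2 = 4 + 3 * k"
    and "I 0 s"
  obtains t s' where "exec (each_edge c) s t s'" "I n s'" "t \<le> (n + 1) * (6 + worst_time c)"
proof -
  have test: "bdefined (NLess vertex_ptr end_ptr) s" "bval (NLess vertex_ptr end_ptr) s \<longleftrightarrow> k < n"
    if "I k s" for k s
    using ptr[OF that] by (simp_all add: vertex_ptr_def end_ptr_def e)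
  have cost: "1 + bcost (NLess vertex_ptr end_ptr) = 6"
    by (simp add: vertex_ptr_def end_ptr_def)
  show thesis
  proof (rule exec_While_count[of n I "NLess vertex_ptr end_ptr" c s])
    fix k s assume "k < n" "I k s"
    then show "bdefined (NLess vertex_ptr end_ptr) s \<and> bval (NLess vertex_ptr end_ptr) s \<and>
        safe c s \<and> I (Suc k) (run c s)"
      using test step by blast
  next
    fix s assume "I n s"
    then show "bdefined (NLess vertex_ptr end_ptr) s \<and> \<not> bval (NLess vertex_ptr end_ptr) s"
      using test by blast
  next
    fix t s'
    assume "exec (While (NLess vertex_ptr end_ptr) c) s t s'" "I n s'"
      "t \<le> (n + 1) * (1 + bcost (NLess vertex_ptr end_ptr) + worst_time c)"
    then show thesis unfolding cost by (intro that) (simp_all add: each_edge_def)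
  qed fact
qed

end

definition time_bound :: "nat \<Rightarrow> nat" where
  "time_bound n = (n + 1) * (30 + worst_time setup_program + worst_time add_cross + worst_time disc_setup
     + worst_time add_edge_term)"

context polygon_input
begin

lemma normal_inv_ptr: "normal_inv k s \<Longrightarrow> nat_mem s 1 = e \<and> nat_mem s 2 = 4 + 3 * k"
  by (simp add: normal_inv_def loaded_def)

lemma area_inv_ptr: "area_inv k s \<Longrightarrow> nat_mem s 1 = e \<and> nat_mem s 2 = 4 + 3 * k"
  by (simp add: area_inv_def loaded_def)

lemma exec_cdf_program:
  assumes N: "N \<noteq> 0" and distinct: "\<And>i. i < n \<Longrightarrow> from_vec i \<noteq> to_vec i"
  obtains t s where "exec cdf_program (input vs P d) t s" "t \<le> time_bound n"
    "result s = (if R \<le> 0 then 0 else partial_area n / norm N)"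
proof -
  let ?s1 = "run setup_program (input vs P d)"
  obtain t1 where t1: "t1 \<le> worst_time setup_program" "exec setup_program (input vs P d) t1 ?s1"
    using exec_run[OF run_setup(1)] by blast
  have "normal_inv 0 ?s1"
  proof -
    have l: "loaded (nat_mem ?s1) (real_mem ?s1)"
      using run_setup(2,4) by (simp add: loaded_def)
    have "real_mem ?s1 (j + e) = 0" if "3 \<le> j" for j
      using that by (simp add: run_setup(4) closed_mem_high)
    then show ?thesis
      using l run_setup(3) by (simp add: normal_inv_def vval_normal partial_normal_def vec_eq_iff forall_3)
  qed
  from each_edge_exec[OF normal_step normal_inv_ptr this]
  obtain t2 s2 where t2: "exec (each_edge add_cross) ?s1 t2 s2" "normal_inv n s2"
    "t2 \<le> (n + 1) * (6 + worst_time add_cross)"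
    by blast
  have s3: "safe disc_setup s2" "area_inv 0 (run disc_setup s2)"
    using disc_setup_step[OF t2(2) N] by auto
  let ?s3 = "run disc_setup s2"
  obtain t3 where t3: "t3 \<le> worst_time disc_setup" "exec disc_setup s2 t3 ?s3"
    using exec_run[OF s3(1)] by blast
  let ?b = "RLess (RConst 0) radius_sq"
  let ?A = "Seq (each_edge add_edge_term) (RStore (NConst 0) (RDiv area_sum normal_length))"
  let ?B = "RStore (NConst 0) (RConst 0)"
  have b: "bdefined ?b ?s3" "bval ?b ?s3 \<longleftrightarrow> 0 < R"
    using s3(2) by (simp_all add: radius_sq_def area_inv_def)
  have bcost: "bcost ?b = 7"
    by (simp add: radius_sq_def scratch_def end_ptr_def)
  obtain t4 s4 where t4: "exec (Cond ?b ?A ?B) ?s3 t4 s4" "t4 \<le> 25 + (n + 1) * (6 + worst_time add_edge_term)"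
    "result s4 = (if R \<le> 0 then 0 else partial_area n / norm N)"
  proof (cases "0 < R")
    case True
    from each_edge_exec[of area_inv, OF area_step[OF _ _ N distinct] area_inv_ptr s3(2)]
    obtain t5 s5 where t5: "exec (each_edge add_edge_term) ?s3 t5 s5" "area_inv n s5"
      "t5 \<le> (n + 1) * (6 + worst_time add_edge_term)"
      by blast
    have safe: "rdefined (RDiv area_sum normal_length) s5" "rval (RDiv area_sum normal_length) s5 = partial_area n / norm N"
      using t5(2) N by (simp_all add: area_inv_def area_sum_def normal_length_def)
    have cost: "rcost (RDiv area_sum normal_length) = 11"
      by (simp add: area_sum_def normal_length_def scratch_def end_ptr_def)
    show thesis
    proof (rule that)
      show "exec (Cond ?b ?A ?B) ?s3 (1 + bcost ?b + (1 + t5 + (1 + ncost (NConst 0) + rcost (RDiv area_sum normal_length))))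
         (s5\<lparr>real_mem := (real_mem s5)(nval (NConst 0) s5 := rval (RDiv area_sum normal_length) s5)\<rparr>)"
        using b True by (intro exec.CondTrue exec.Seq[OF t5(1) exec.RStore[OF safe(1)]]) auto
      show "1 + bcost ?b + (1 + t5 + (1 + ncost (NConst 0) + rcost (RDiv area_sum normal_length)))
          \<le> 25 + (n + 1) * (6 + worst_time add_edge_term)"
        unfolding bcost cost using t5(3) by simp
      show "result (s5\<lparr>real_mem := (real_mem s5)(nval (NConst 0) s5 := rval (RDiv area_sum normal_length) s5)\<rparr>) =
          (if R \<le> 0 then 0 else partial_area n / norm N)"
        unfolding safe(2) using True by (simp add: result_def)
    qed
  next
    case False
    show thesis
    proof (rule that)
      show "exec (Cond ?b ?A ?B) ?s3 (1 + bcost ?b + (1 + ncost (NConst 0) + rcost (RConst 0)))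
         (?s3\<lparr>real_mem := (real_mem ?s3)(nval (NConst 0) ?s3 := rval (RConst 0) ?s3)\<rparr>)"
        using b False by (intro exec.CondFalse exec.RStore) auto
      show "1 + bcost ?b + (1 + ncost (NConst 0) + rcost (RConst 0)) \<le> 25 + (n + 1) * (6 + worst_time add_edge_term)"
        unfolding bcost by simp
    qed (use False in \<open>simp add: result_def\<close>)
  qed
  show thesis
  proof (rule that)
    show "exec cdf_program (input vs P d) (1 + t1 + (1 + t2 + (1 + t3 + t4))) s4"
      unfolding cdf_program_def using t1(2) t2(1) t3(2) t4(1) by (intro exec.Seq)
    show "1 + t1 + (1 + t2 + (1 + t3 + t4)) \<le> time_bound n"
    proof -
      have "x \<le> (n + 1) * x" for x :: nat by simp
      from this[of "worst_time setup_program"] this[of "worst_time disc_setup"] show ?thesis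
        using t1(1) t2(3) t3(1) t4(2) n(2) by (simp add: time_bound_def algebra_simps)
    qed
  qed (rule t4(3))
qed

end

lemma time_bound_bigo: "(\<lambda>n. real (time_bound n)) \<in> O(\<lambda>n. real n * ln (real n))"
proof -
  obtain K where K: "\<And>n. time_bound n = (n + 1) * K" by (metis time_bound_def)
  show ?thesis
  proof (rule bigoI)
    show "\<forall>\<^sub>F n in sequentially. norm (real (time_bound n)) \<le> 2 * real K * norm (real n * ln (real n))"
      using eventually_ge_at_top[of 3]
    proof eventually_elim
      case (elim n)
      \<comment> \<open>the natural logarithm is at least \<open>1\<close> from \<open>3\<close> on\<close>
      have "exp 1 \<le> real n" using exp_le elim by linarith
      then have ln: "1 \<le> ln (real n)" using elim by (subst ln_ge_iff) auto
      have "real (time_bound n) \<le> 2 * real K * real n"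
      proof -
        have "time_bound n \<le> 2 * K * n"
          using mult_le_mono1[of "n + 1" "2 * n" K] elim by (simp add: K mult_ac)
        from of_nat_mono[OF this, where 'a = real] show ?thesis by simp
      qed
      also have "\<dots> \<le> 2 * real K * (real n * ln (real n))"
        using ln by (intro mult_left_mono) (auto simp: mult_le_cancel_left1)
      finally show ?case using ln by simp
    qed
  qed
qed

lemma cdf_distance_law:
  assumes A: "compact A" and pos: "0 < c" and area: "emeasure (plane_area H) A = ennreal c"
  shows "cdf (distance_law H A P) d =
    measure (plane_area H) (A \<inter> cball P d) / measure (plane_area H) A"
proof -
  let ?U = "uniform_measure (plane_area H) A"
  have [simp]: "sets (plane_area H) = sets borel" "space (plane_area H) = UNIV"
    by (simp_all add: plane_area_def)
  have "(\<lambda>X. norm (X - P)) \<in> borel_measurable borel"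
    by (intro borel_measurable_continuous_onI continuous_intros)
  then have "(\<lambda>X. norm (X - P)) \<in> borel_measurable ?U"
    by (simp cong: measurable_cong_sets)
  then have "cdf (distance_law H A P) d = measure ?U ((\<lambda>X. norm (X - P)) -` {..d} \<inter> space ?U)"
    by (simp add: cdf_def distance_law_def measure_distr)
  also have "(\<lambda>X. norm (X - P)) -` {..d} \<inter> space ?U = cball P d"
    by (auto simp: dist_norm norm_minus_commute)
  also have "measure ?U (cball P d) = measure (plane_area H) (A \<inter> cball P d) / measure (plane_area H) A"
    using A pos area by (intro measure_uniform_measure) (simp_all add: borel_compact)
  finally show ?thesis .
qed

theorem mainTheorem4:
  shows "\<exists>(prog :: com) (T :: nat \<Rightarrow> nat).
    (\<lambda>n. real (T n)) \<in> O(\<lambda>n. real n * ln (real n)) \<and>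
    (\<forall>(H :: point set) (vs :: point list) (P :: point) (d :: real).
       plane H \<longrightarrow> set vs \<subseteq> H \<longrightarrow> simple_polygon vs \<longrightarrow> 0 \<le> d \<longrightarrow>
       (\<exists>t s. exec prog (input vs P d) t s \<and>
              t \<le> T (length vs) \<and>
              result s = cdf (distance_law H (polygon_region H vs) P) d \<and>
              cdf (distance_law H (polygon_region H vs) P) d =
                measure (plane_area H) (polygon_region H vs \<inter> cball P d) /
                measure (plane_area H) (polygon_region H vs)))"
proof (intro exI[of _ cdf_program] exI[of _ time_bound] conjI time_bound_bigo allI impI)
  fix H :: "point set" and vs :: "point list" and P :: point and d :: real
  assume H: "plane H" "set vs \<subseteq> H" "simple_polygon vs" "0 \<le> d"
  define n where "n = length vs"
  have vs: "3 \<le> n" "distinct vs" using H(3) by (simp_all add: simple_polygon_def n_def)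
  interpret polygon_input vs P d n "4 + 3 * n"
    by unfold_locales (use vs in \<open>simp_all add: n_def\<close>)
  let ?S = "polygon_region H vs"
  have N: "N = doubled_vector_area P vs"
    unfolding N_def partial_normal_def doubled_vector_area_def from_vec_def to_vec_def
    unfolding n_def ..
  note geometry = polygon_region_disc_area(1)[OF H, of P, folded N]
    polygon_region_disc_area(2)[OF H] polygon_region_disc_area(3,4)[OF H, of P, folded N]
  have pos: "0 < norm N" by (rule geometry(1))
  have R: "R = d\<^sup>2 - (N \<bullet> (vs ! 0 - P) / norm N)\<^sup>2"
    by (simp add: R_def from_vec_def)
  have disc: "measure (plane_area H) (?S \<inter> cball P d) = (if R \<le> 0 then 0 else partial_area n / 2)"
    unfolding geometry(4) R[symmetric] partial_area_def det_at_def from_vec_def to_vec_def Let_def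
    unfolding n_def ..
  have area: "measure (plane_area H) ?S = norm N / 2"
    using geometry(3) by (simp add: measure_def)
  have cdf: "cdf (distance_law H ?S P) d = measure (plane_area H) (?S \<inter> cball P d) / measure (plane_area H) ?S"
    using geometry(2,3) pos by (intro cdf_distance_law[where c = "norm N / 2"]) auto
  have "from_vec i \<noteq> to_vec i" if "i < n" for i
  proof -
    have "i \<noteq> Suc i mod n" using that vs(1) by (cases "Suc i = n") auto
    moreover have "Suc i mod n < length vs" "i < length vs"
      using vs(1) that unfolding n_def by (auto intro!: mod_less_divisor)
    ultimately have "vs ! i \<noteq> vs ! (Suc i mod n)"
      using vs(2) by (simp add: nth_eq_iff_index_eq)
    then show ?thesis by (simp add: from_vec_def to_vec_def)
  qed
  then obtain t s where "exec cdf_program (input vs P d) t s" "t \<le> time_bound n"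
    "result s = (if R \<le> 0 then 0 else partial_area n / norm N)"
    using exec_cdf_program pos by auto
  then show "\<exists>t s. exec cdf_program (input vs P d) t s \<and> t \<le> time_bound (length vs) \<and>
      result s = cdf (distance_law H ?S P) d \<and>
      cdf (distance_law H ?S P) d =
        measure (plane_area H) (?S \<inter> cball P d) / measure (plane_area H) ?S"
    using pos by (intro exI[of _ t] exI[of _ s]) (simp add: cdf disc area n_def)
qed

end
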